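(* Let $F$ be a graph with at least one edge, and let $r\geq 2$ be an integer. If $d>0$ is a real number such that Builder has a winning strategy in the deterministic $F$-avoidance game with $r$ colors and density restriction $d$, then the threshold of the online $F$-avoidance game with $r$ colors satisfies \[ N_0(F,r,n)\leq n^{2-1/d}. \]
   Context: Online $F$-avoidance game with $r$ colors (probabilistic one-player game): the board is a graph on $n$ vertices, initially without edges. In each step a new edge is drawn uniformly at random from all non-edges and presented to the player Painter, who must immediately assign it one of $r$ colors. The game ends as soon as a monochromatic copy of $F$ is created; Painter wants to survive as many steps as possible. The threshold $N_0=N_0(F,r,n)$ is a function such that: for any $N=o(N_0)$ there is a coloring strategy that asymptotically almost surely (with probability $1-o(1)$ as $n\to\infty$) creates no monochromatic copy of $F$ in the first $N$ steps, while for $N=\omega(N_0)$ every online strategy asymptotically almost surely creates a monochromatic copy of $F$ within the first $N$ steps. An upper bound $N_0\le g$ means that for $N=\omega(g)$ every online Painter strategy a.a.s. creates a monochromatic copy of $F$ within the first $N$ steps. Deterministic $F$-avoidance game with $r$ colors and density restriction $d$ (on a board with $a$ vertices): two players Builder and Painter play on $a$ vertices. In each step Builder presents a new edge, which Painter must immediately color with one of $r$ colors; Painter loses as soon as a monochromatic copy of $F$ is created. Builder must never present an edge that would make the board $B$ violate $m(B)\le d$, where $m(B)=\max_{H\subseteq B} e_H/v_H$ ($e_H$, $v_H$ the numbers of edges and vertices of $H$). Builder has a winning strategy if, for some sufficiently large integer $a$, he can force Painter to create a monochromatic copy of $F$ on a board with $a$ vertices. *)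

theory Defs
  imports
    "HOL-Probability.Probability"
    "HOL-Library.Ramsey"
    "HOL-Library.Landau_Symbols"
begin

type_synonym 'a ugraph = "'a set \<times> 'a set set"

abbreviation uverts :: "'a ugraph \<Rightarrow> 'a set" where
  "uverts G \<equiv> fst G"

abbreviation uedges :: "'a ugraph \<Rightarrow> 'a set set" where
  "uedges G \<equiv> snd G"

definition simple_graph :: "'a ugraph \<Rightarrow> bool" where
  "simple_graph G \<longleftrightarrow> finite (uverts G) \<and> uedges G \<subseteq> [uverts G]\<^bsup>2\<^esup>"

definition subgraph :: "'a ugraph \<Rightarrow> 'a ugraph \<Rightarrow> bool" where
  "subgraph H G \<longleftrightarrow> simple_graph H \<and> uverts H \<subseteq> uverts G \<and> uedges H \<subseteq> uedges G"

definition max_density :: "'a ugraph \<Rightarrow> real" where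
  "max_density G =
     Max {real (card (uedges H)) / real (card (uverts H)) | H. subgraph H G \<and> uverts H \<noteq> {}}"

text \<open>A board has vertex set \<open>{..<n}\<close>. The state of either game is the list of the
  edges presented so far together with their colors, oldest first.\<close>

type_synonym edge = "nat set"
type_synonym history = "(edge \<times> nat) list"

definition board :: "nat \<Rightarrow> history \<Rightarrow> nat ugraph" where
  "board n h = ({..<n}, fst ` set h)"

definition non_edges :: "nat \<Rightarrow> history \<Rightarrow> edge set" where
  "non_edges n h = [{..<n}]\<^bsup>2\<^esup> - uedges (board n h)"

text \<open>Copies are not required to be induced.\<close>

definition mono_copy :: "'a ugraph \<Rightarrow> nat \<Rightarrow> history \<Rightarrow> bool" where
  "mono_copy F n h \<longleftrightarrow>
     (\<exists>c \<phi>. inj_on \<phi> (uverts F) \<and> \<phi> ` uverts F \<subseteq> uverts (board n h) \<and>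
        (\<forall>e \<in> uedges F. (\<phi> ` e, c) \<in> set h))"

text \<open>In the probabilistic game Painter may randomize: given the history and the new
  edge, a strategy returns a distribution on the colors \<open>{..<r}\<close>. Deterministic
  strategies are the point masses.\<close>

type_synonym online_strategy = "history \<Rightarrow> edge \<Rightarrow> nat pmf"

definition online_painter :: "nat \<Rightarrow> online_strategy \<Rightarrow> bool" where
  "online_painter r \<sigma> \<longleftrightarrow> (\<forall>h e. set_pmf (\<sigma> h e) \<subseteq> {..<r})"

text \<open>The state stays fixed once the game has ended or the board is complete (in the
  latter case \<open>pmf_of_set\<close> would be applied to the empty set).\<close>

definition online_step ::
  "'a ugraph \<Rightarrow> nat \<Rightarrow> online_strategy \<Rightarrow> history \<Rightarrow> history pmf" where
  "online_step F n \<sigma> h =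
     (if mono_copy F n h \<or> non_edges n h = {} then return_pmf h
      else bind_pmf (pmf_of_set (non_edges n h)) (\<lambda>e.
             map_pmf (\<lambda>c. h @ [(e, c)]) (\<sigma> h e)))"

primrec online_game ::
  "'a ugraph \<Rightarrow> nat \<Rightarrow> online_strategy \<Rightarrow> nat \<Rightarrow> history pmf" where
  "online_game F n \<sigma> 0 = return_pmf []"
| "online_game F n \<sigma> (Suc k) = bind_pmf (online_game F n \<sigma> k) (online_step F n \<sigma>)"

text \<open>The upper bound \<open>N\<^sub>0(F, r, n) \<le> g n\<close> on the threshold. A Painter strategy for the
  asymptotic game is a family of strategies, one for each board size.\<close>

definition threshold_upper_bound :: "'a ugraph \<Rightarrow> nat \<Rightarrow> (nat \<Rightarrow> real) \<Rightarrow> bool" where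
  "threshold_upper_bound F r g \<longleftrightarrow>
     (\<forall>N :: nat \<Rightarrow> nat. (\<lambda>n. real (N n)) \<in> \<omega>(g) \<longrightarrow>
        (\<forall>\<sigma> :: nat \<Rightarrow> online_strategy. (\<forall>n. online_painter r (\<sigma> n)) \<longrightarrow>
           (\<lambda>n. measure_pmf.prob (online_game F n (\<sigma> n) (N n)) {h. mono_copy F n h})
             \<longlonglongrightarrow> 1))"

definition legal_move :: "nat \<Rightarrow> real \<Rightarrow> history \<Rightarrow> edge \<Rightarrow> bool" where
  "legal_move a d h e \<longleftrightarrow>
     e \<in> non_edges a h \<and>
     max_density (uverts (board a h), insert e (uedges (board a h))) \<le> d"

primrec det_play ::
  "(history \<Rightarrow> edge) \<Rightarrow> (history \<Rightarrow> edge \<Rightarrow> nat) \<Rightarrow> nat \<Rightarrow> history" where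
  "det_play \<beta> \<pi> 0 = []"
| "det_play \<beta> \<pi> (Suc k) =
     (let h = det_play \<beta> \<pi> k; e = \<beta> h in h @ [(e, \<pi> h e)])"

definition builder_wins_on :: "'a ugraph \<Rightarrow> nat \<Rightarrow> real \<Rightarrow> nat \<Rightarrow> bool" where
  "builder_wins_on F r d a \<longleftrightarrow>
     (\<exists>\<beta> :: history \<Rightarrow> edge.
        \<forall>\<pi> :: history \<Rightarrow> edge \<Rightarrow> nat. (\<forall>h e. \<pi> h e < r) \<longrightarrow>
          (\<exists>k. (\<forall>j<k. legal_move a d (det_play \<beta> \<pi> j) (\<beta> (det_play \<beta> \<pi> j))) \<and>
               mono_copy F a (det_play \<beta> \<pi> k)))"

definition builder_has_winning_strategy :: "'a ugraph \<Rightarrow> nat \<Rightarrow> real \<Rightarrow> bool" where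
  "builder_has_winning_strategy F r d \<longleftrightarrow> (\<exists>a. builder_wins_on F r d a)"

end

theory Submission
  imports Defs "HOL-Real_Asymp.Real_Asymp"
begin

text \<open>
  Builder's strategy on \<open>a\<close> vertices is simulated in rounds of \<open>L\<close> random edges, one round per
  Builder move. Put \<open>p = \<Theta>(L / n\<^sup>2)\<close>; only \<open>N = \<omega>(n powr (2 - 1/d))\<close> with
  \<open>p \<rightarrow> 0\<close> matters. With probability \<open>1 - o(1)\<close>, after \<open>k\<close> rounds either the game is lost or some
  \<open>k\<close>-step position of the deterministic game has \<open>\<Omega>(n^a p^k)\<close> embedded copies on the random board.
  For the step from \<open>k\<close> to \<open>k + 1\<close>, few copies have the next edge of Builder already present, since
  that costs another factor \<open>p\<close>. Weight each non-edge \<open>f\<close> by the number of copies in which Builder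
  would play \<open>f\<close>; by Chebyshev the edges drawn in the round capture a \<open>\<Theta>(p)\<close> fraction of the total
  weight, and one of the \<open>r\<close> colors gets a constant share of it. The sum of the squared weights
  counts pairs of copies that agree on the next edge \<open>e\<close>. If such a pair overlaps in \<open>J\<close>, the density
  restriction for \<open>J + e\<close> bounds its contribution by a factor
  \<open>p (p powr -d / n)^v(J)\<close> relative to \<open>n^(2a) p^(2k)\<close>, and \<open>p powr -d / n = o(1)\<close>.
  No position has more than \<open>a choose 2\<close> edges, so the game is lost after that many rounds plus one.
\<close>

section \<open>The edge process\<close>

lemma measure_bind_pmf:
  "measure_pmf.prob (bind_pmf M f) A = (\<integral>x. measure_pmf.prob (f x) A \<partial>measure_pmf M)"
proof -
  have int: "integrable (measure_pmf M) (\<lambda>x. measure_pmf.prob (f x) A)"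
    by (rule measure_pmf.integrable_const_bound[where B = 1]) auto
  have "ennreal (measure_pmf.prob (bind_pmf M f) A) = (\<integral>\<^sup>+x. emeasure (measure_pmf (f x)) A \<partial>measure_pmf M)"
    by (simp add: measure_pmf.emeasure_eq_measure[symmetric])
  also have "\<dots> = ennreal (\<integral>x. measure_pmf.prob (f x) A \<partial>measure_pmf M)"
    using nn_integral_eq_integral[OF int] by (simp add: measure_pmf.emeasure_eq_measure)
  finally show ?thesis
    by (simp add: integral_nonneg_AE)
qed

lemma prob_mono_on_support:
  assumes "\<And>x. x \<in> set_pmf M \<Longrightarrow> x \<in> A \<Longrightarrow> x \<in> B"
  shows "measure_pmf.prob M A \<le> measure_pmf.prob M B"
  by (rule measure_pmf.finite_measure_mono_AE) (auto simp: AE_measure_pmf_iff assms)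

lemma prob_cong_on_support:
  assumes "\<And>x. x \<in> set_pmf M \<Longrightarrow> x \<in> A \<longleftrightarrow> x \<in> B"
  shows "measure_pmf.prob M A = measure_pmf.prob M B"
  by (intro antisym prob_mono_on_support) (use assms in auto)

text \<open>The recursion peels off the first step, while \<open>online_game\<close> appends the
  last one. This form suits first-step analysis by induction with an arbitrary starting
  state.\<close>

primrec kernel_iter :: "('s \<Rightarrow> 's pmf) \<Rightarrow> nat \<Rightarrow> 's \<Rightarrow> 's pmf" where
  "kernel_iter f 0 s = return_pmf s"
| "kernel_iter f (Suc k) s = bind_pmf (f s) (kernel_iter f k)"

text \<open>Chapman-Kolmogorov identity; it later splits the process into rounds.\<close>

lemma kernel_iter_add:
  "kernel_iter f (j + k) s = bind_pmf (kernel_iter f j s) (kernel_iter f k)"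
  by (induction j arbitrary: s) (auto simp: bind_return_pmf bind_assoc_pmf intro!: bind_pmf_cong)

lemma online_game_eq_kernel_iter:
  "online_game F n \<sigma> k = kernel_iter (online_step F n \<sigma>) k []"
proof (induction k)
  case (Suc k)
  have zero: "kernel_iter (online_step F n \<sigma>) 0 = return_pmf"
    by (simp add: fun_eq_iff)
  have "kernel_iter (online_step F n \<sigma>) 1 = online_step F n \<sigma>"
    by (rule ext) (simp only: One_nat_def kernel_iter.simps(2) zero bind_return_pmf')
  then show ?case
    using kernel_iter_add[of "online_step F n \<sigma>" k 1 "[]"] Suc by simp
qed simp

text \<open>Unlike the online game this process does not stop at a monochromatic copy of \<open>F\<close>, so that
  the set of edges drawn does not depend on Painter.\<close>

definition free_step :: "nat \<Rightarrow> online_strategy \<Rightarrow> history \<Rightarrow> history pmf" where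
  "free_step n \<sigma> h =
     (if non_edges n h = {} then return_pmf h
      else bind_pmf (pmf_of_set (non_edges n h)) (\<lambda>e.
             map_pmf (\<lambda>c. h @ [(e, c)]) (\<sigma> h e)))"

lemma finite_non_edges [simp]: "finite (non_edges n h)"
  by (simp add: non_edges_def finite_imp_finite_nsets)

lemma non_edges_snoc [simp]: "non_edges n (h @ [(e, c)]) = non_edges n h - {e}"
  by (auto simp: non_edges_def board_def)

lemma mono_copy_mono: "mono_copy F n h \<Longrightarrow> set h \<subseteq> set h' \<Longrightarrow> mono_copy F n h'"
  unfolding mono_copy_def board_def by fastforce

lemma set_pmf_free_step:
  "h' \<in> set_pmf (free_step n \<sigma> h) \<Longrightarrow>
     (non_edges n h = {} \<and> h' = h) \<or>
     (\<exists>e\<in>non_edges n h. \<exists>c\<in>set_pmf (\<sigma> h e). h' = h @ [(e, c)])"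
  by (auto simp: free_step_def split: if_splits)

lemma free_extends:
  "h' \<in> set_pmf (kernel_iter (free_step n \<sigma>) t h) \<Longrightarrow> set h \<subseteq> set h'"
proof (induction t arbitrary: h)
  case (Suc t)
  then obtain h1 where "h1 \<in> set_pmf (free_step n \<sigma> h)"
    "h' \<in> set_pmf (kernel_iter (free_step n \<sigma>) t h1)" by auto
  then show ?case
    using Suc.IH[of h1] set_pmf_free_step[of h1 n \<sigma> h] by auto
qed simp

text \<open>Each step consumes exactly one non-edge as long as any are left. This leaves enough room
  for the next round, and the old history stays a prefix, so the edges of a round can be told apart
  from earlier ones.\<close>

lemma free_invariants:
  assumes "online_painter r \<sigma>"
  shows "t \<le> card (non_edges n h) \<Longrightarrow> h' \<in> set_pmf (kernel_iter (free_step n \<sigma>) t h) \<Longrightarrow>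
    \<exists>s. h' = h @ s \<and> snd ` set s \<subseteq> {..<r} \<and> card (non_edges n h') = card (non_edges n h) - t"
proof (induction t arbitrary: h)
  case (Suc t)
  then obtain h1 where h1: "h1 \<in> set_pmf (free_step n \<sigma> h)"
    "h' \<in> set_pmf (kernel_iter (free_step n \<sigma>) t h1)" by auto
  have "non_edges n h \<noteq> {}" using Suc.prems by auto
  with set_pmf_free_step[OF h1(1)] obtain e c where
    e: "e \<in> non_edges n h" "c \<in> set_pmf (\<sigma> h e)" "h1 = h @ [(e, c)]" by blast
  have c: "c < r" using e(2) assms by (auto simp: online_painter_def)
  have crd: "card (non_edges n h1) = card (non_edges n h) - 1"
    using e by simp
  then have "t \<le> card (non_edges n h1)" using Suc.prems(1) by simp
  from Suc.IH[OF this h1(2)] obtain s where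
    "h' = h1 @ s" "snd ` set s \<subseteq> {..<r}" "card (non_edges n h') = card (non_edges n h1) - t" by blast
  then show ?case
    using c crd e(3) by (intro exI[of _ "(e, c) # s"]) auto
qed simp

text \<open>The two processes take the same step until a copy appears. From then on the game is
  frozen, and the free process can only add edges, so neither loses the copy.\<close>

lemma prob_mono_copy_free:
  "measure_pmf.prob (kernel_iter (online_step F n \<sigma>) k h) {h. mono_copy F n h} =
   measure_pmf.prob (kernel_iter (free_step n \<sigma>) k h) {h. mono_copy F n h}"
proof (induction k arbitrary: h)
  case (Suc k)
  show ?case
  proof (cases "mono_copy F n h")
    case True
    have stop: "kernel_iter (online_step F n \<sigma>) j h = return_pmf h" for j
      using True by (induction j) (auto simp: online_step_def bind_return_pmf)
    have "measure_pmf.prob (kernel_iter (free_step n \<sigma>) (Suc k) h) {h. mono_copy F n h}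
        = measure_pmf.prob (kernel_iter (free_step n \<sigma>) (Suc k) h) UNIV"
      using free_extends[of _ n \<sigma> "Suc k" h] mono_copy_mono[OF True]
      by (intro prob_cong_on_support) auto
    then show ?thesis using True by (simp only: stop) simp
  next
    case False
    then have "online_step F n \<sigma> h = free_step n \<sigma> h"
      by (simp add: online_step_def free_step_def)
    then show ?thesis by (simp add: measure_bind_pmf Suc)
  qed
qed simp

text \<open>The histories after \<open>j\<close> steps are compared with their continuations: a copy
  already present survives. This allows the rounds to use up only part of the available
  steps.\<close>

lemma prob_mono_copy_free_mono:
  assumes "j \<le> k"
  shows "measure_pmf.prob (kernel_iter (free_step n \<sigma>) j h) {h. mono_copy F n h} \<le>
         measure_pmf.prob (kernel_iter (free_step n \<sigma>) k h) {h. mono_copy F n h}"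
proof -
  let ?S = "{h. mono_copy F n h}"
  obtain i where k: "k = j + i" using assms le_Suc_ex by blast
  have "measure_pmf.prob (kernel_iter (free_step n \<sigma>) j h) ?S
      = measure_pmf.prob (bind_pmf (kernel_iter (free_step n \<sigma>) j h) return_pmf) ?S"
    by (simp add: bind_return_pmf')
  also have "\<dots> \<le> measure_pmf.prob (kernel_iter (free_step n \<sigma>) k h) ?S"
    unfolding k kernel_iter_add measure_bind_pmf
  proof (intro integral_mono_AE)
    show "integrable (measure_pmf (kernel_iter (free_step n \<sigma>) j h)) (\<lambda>x. measure_pmf.prob (return_pmf x) ?S)"
      "integrable (measure_pmf (kernel_iter (free_step n \<sigma>) j h))
         (\<lambda>x. measure_pmf.prob (kernel_iter (free_step n \<sigma>) i x) ?S)"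
      by (rule measure_pmf.integrable_const_bound[where B = 1]; auto)+
    have "measure_pmf.prob (return_pmf x) ?S \<le> measure_pmf.prob (kernel_iter (free_step n \<sigma>) i x) ?S" for x
    proof (cases "mono_copy F n x")
      case True
      have "measure_pmf.prob (kernel_iter (free_step n \<sigma>) i x) ?S
          = measure_pmf.prob (kernel_iter (free_step n \<sigma>) i x) UNIV"
        using free_extends[of _ n \<sigma> i x] mono_copy_mono[OF True]
        by (intro prob_cong_on_support) auto
      then show ?thesis by simp
    qed simp
    then show "AE x in measure_pmf (kernel_iter (free_step n \<sigma>) j h).
      measure_pmf.prob (return_pmf x) ?S \<le> measure_pmf.prob (kernel_iter (free_step n \<sigma>) i x) ?S"
      by simp
  qed
  finally show ?thesis .
qed

section \<open>The set of drawn edges: hypergeometric law and second moment\<close>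

text \<open>This is conditioning on the first of \<open>Suc t\<close> draws from \<open>m\<close>
  items. With probability \<open>s / m\<close> it hits a given \<open>s\<close>-set, and
  \<open>s - 1\<close> items remain to be hit; otherwise all \<open>s\<close> remain. Both cases
  continue with \<open>t\<close> draws from \<open>m - 1\<close> items.\<close>

lemma binomial_ratio_Suc:
  assumes "Suc t \<le> m" "s \<le> m"
  shows "(real s * (real (t choose (s - 1)) / real (m - 1 choose (s - 1)))
      + real (m - s) * (real (t choose s) / real (m - 1 choose s))) / real m
      = real (Suc t choose s) / real (m choose s)"
proof (cases s)
  case 0
  then show ?thesis using assms by simp
next
  case s: (Suc s')
  obtain m' where m': "m = Suc m'" using assms by (cases m) auto
  have pos: "real (m' choose s') > 0" "real (m choose s) > 0" "real m > 0"
    using assms s m' by (simp_all add: zero_less_binomial_iff del: binomial_Suc_Suc)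
  have 1: "real s * real (m choose s) = real m * real (m' choose s')"
    unfolding s m' by (metis of_nat_mult Suc_times_binomial)
  have "real s * (real (t choose s') / real (m' choose s')) / real m
      = real (t choose s') * real s / (real m * real (m' choose s'))"
    by (simp add: mult.commute)
  also have "\<dots> = real (t choose s') / real (m choose s)"
    unfolding 1[symmetric] using s by simp
  finally have A: "real s * (real (t choose s') / real (m' choose s')) / real m
      = real (t choose s') / real (m choose s)" .
  have B: "real (m - s) * (real (t choose s) / real (m' choose s)) / real m
      = real (t choose s) / real (m choose s)"
  \<comment> \<open>For \<open>s = m\<close> the denominator \<open>m' choose s\<close> is zero, but
    then \<open>m - s = 0\<close>, and the right-hand side vanishes because
    \<open>t < s\<close>.\<close>
  proof (cases "s = m")
    case True
    then show ?thesis using assms by (simp add: binomial_eq_0)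
  next
    case False
    have 2: "real (m - s) * real (m choose s) = real m * real (m' choose s)"
      unfolding m' by (metis binomial_absorb_comp diff_Suc_1 of_nat_mult)
    have "real (m - s) * (real (t choose s) / real (m' choose s)) / real m
        = real (t choose s) * real (m - s) / (real m * real (m' choose s))"
      by (simp add: mult.commute)
    also have "\<dots> = real (t choose s) / real (m choose s)"
      unfolding 2[symmetric] using False assms by simp
    finally show ?thesis .
  qed
  have C: "real (t choose s') + real (t choose s) = real (Suc t choose s)"
    using s by simp
  have D: "s - 1 = s'" "m - 1 = m'" using s m' by simp_all
  show ?thesis
    unfolding D add_divide_distrib A B C[symmetric] ..
qed

text \<open>The drawn edges form a uniformly random \<open>t\<close>-subset of the non-edges,
  whatever Painter does, since colors never influence which edge comes next. The induction
  conditions on the first edge.\<close>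

lemma prob_edges_drawn:
  "t \<le> card (non_edges n h) \<Longrightarrow> S \<subseteq> non_edges n h \<Longrightarrow>
   measure_pmf.prob (kernel_iter (free_step n \<sigma>) t h) {h'. S \<subseteq> fst ` set h'}
     = real (t choose card S) / real (card (non_edges n h) choose card S)"
proof (induction t arbitrary: h S)
  case 0
  then have "finite S" using finite_subset finite_non_edges by blast
  have "S \<subseteq> fst ` set h \<longleftrightarrow> S = {}"
    using 0 by (auto simp: non_edges_def board_def)
  then show ?case using \<open>finite S\<close> by (cases "S = {}") (auto simp: card_gt_0_iff binomial_eq_0)
next
  case (Suc t)
  let ?E = "non_edges n h"
  let ?m = "card ?E"
  let ?s = "card S"
  have fS: "finite S" using Suc.prems finite_subset finite_non_edges by blast
  have ne: "?E \<noteq> {}" using Suc.prems by auto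
  have m: "?m > 0" using ne by (simp add: card_gt_0_iff)
  have s_le: "?s \<le> ?m" using Suc.prems by (simp add: card_mono)
  \<comment> \<open>The conditional probability after the first edge \<open>e\<close>; it depends
    neither on the color of \<open>e\<close> nor on the strategy, so the integral over colors
    disappears.\<close>
  define v where "v e = real (t choose card (S - {e})) / real (?m - 1 choose card (S - {e}))" for e
  have step: "measure_pmf.prob (kernel_iter (free_step n \<sigma>) t (h @ [(e, c)])) {h'. S \<subseteq> fst ` set h'} = v e"
    if e: "e \<in> ?E" for e c
  proof -
    have "measure_pmf.prob (kernel_iter (free_step n \<sigma>) t (h @ [(e, c)])) {h'. S \<subseteq> fst ` set h'}
        = measure_pmf.prob (kernel_iter (free_step n \<sigma>) t (h @ [(e, c)])) {h'. S - {e} \<subseteq> fst ` set h'}"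
    proof (intro prob_cong_on_support)
      fix x assume "x \<in> set_pmf (kernel_iter (free_step n \<sigma>) t (h @ [(e, c)]))"
      from free_extends[OF this] have "e \<in> fst ` set x" by force
      then show "x \<in> {h'. S \<subseteq> fst ` set h'} \<longleftrightarrow> x \<in> {h'. S - {e} \<subseteq> fst ` set h'}" by auto
    qed
    also have "\<dots> = v e"
    proof -
      have "t \<le> card (non_edges n (h @ [(e, c)]))" "S - {e} \<subseteq> non_edges n (h @ [(e, c)])"
        using Suc.prems e by auto
      from Suc.IH[OF this] show ?thesis using e by (simp add: v_def)
    qed
    finally show ?thesis .
  qed
  have "measure_pmf.prob (kernel_iter (free_step n \<sigma>) (Suc t) h) {h'. S \<subseteq> fst ` set h'}
      = (\<integral>e. (\<integral>c. measure_pmf.prob (kernel_iter (free_step n \<sigma>) t (h @ [(e, c)]))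
          {h'. S \<subseteq> fst ` set h'} \<partial>measure_pmf (\<sigma> h e)) \<partial>measure_pmf (pmf_of_set ?E))"
    using ne by (simp add: free_step_def bind_assoc_pmf bind_map_pmf measure_bind_pmf)
  also have "\<dots> = (\<integral>e. v e \<partial>measure_pmf (pmf_of_set ?E))"
    using ne by (intro integral_cong_AE) (simp_all add: AE_measure_pmf_iff step)
  also have "\<dots> = (\<Sum>e\<in>?E. v e) / ?m"
    using ne by (simp add: integral_pmf_of_set)
  also have "(\<Sum>e\<in>?E. v e) = (\<Sum>e\<in>S. v e) + (\<Sum>e\<in>?E - S. v e)"
    using Suc.prems(2) by (simp add: sum.subset_diff add.commute)
  also have "(\<Sum>e\<in>S. v e) = ?s * (real (t choose (?s - 1)) / real (?m - 1 choose (?s - 1)))"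
    using fS by (simp add: v_def)
  also have "(\<Sum>e\<in>?E - S. v e) = (\<Sum>e\<in>?E - S. real (t choose ?s) / real (?m - 1 choose ?s))"
    by (intro sum.cong) (auto simp: v_def)
  also have "\<dots> = real (?m - ?s) * (real (t choose ?s) / real (?m - 1 choose ?s))"
    using Suc.prems fS by (simp add: card_Diff_subset of_nat_diff)
  also have "(?s * (real (t choose (?s - 1)) / real (?m - 1 choose (?s - 1)))
      + real (?m - ?s) * (real (t choose ?s) / real (?m - 1 choose ?s))) / ?m
      = real (Suc t choose ?s) / real (?m choose ?s)"
    using Suc.prems(1) s_le by (rule binomial_ratio_Suc)
  finally show ?case .
qed

text \<open>The ratio is the product of the factors \<open>(t - i) / (m - i)\<close> for
  \<open>i < s\<close>, and each is at most \<open>t / m\<close> because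
  \<open>t \<le> m\<close>.\<close>

lemma binomial_ratio_le:
  assumes "t \<le> m"
  shows "real (t choose s) / real (m choose s) \<le> (real t / real m) ^ s"
proof (cases "s \<le> t \<and> m > 0")
  case True
  then have "s \<le> t" "m > 0" by auto
  then have "real (t choose s) * real m ^ s \<le> real (m choose s) * real t ^ s"
  proof (induction s)
    case (Suc s)
    have rec: "real (Suc s) * real (x choose Suc s) = real (x - s) * real (x choose s)" for x
      using binomial_absorption[of s x] binomial_absorb_comp[of x s] by (metis of_nat_mult)
    have "real (t - s) * m \<le> real (m - s) * t"
      using assms Suc.prems mult_left_mono[of "real t" "real m" "real s"]
      by (simp add: of_nat_diff algebra_simps)
    then have "(real (t - s) * m) * (real (t choose s) * real m ^ s)
        \<le> (real (m - s) * t) * (real (m choose s) * real t ^ s)"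
      using Suc by (intro mult_mono[of "real (t - s) * m"]) auto
    then have "(real (t - s) * real (t choose s)) * real m ^ Suc s
        \<le> (real (m - s) * real (m choose s)) * real t ^ Suc s"
      by (simp add: mult_ac)
    then have "real (Suc s) * (real (t choose Suc s) * real m ^ Suc s)
        \<le> real (Suc s) * (real (m choose Suc s) * real t ^ Suc s)"
      unfolding rec[symmetric] by (simp only: mult.assoc)
    then show ?case by (rule mult_left_le_imp_le) simp
  qed simp
  moreover have "m choose s > 0" using True assms by (simp add: zero_less_binomial_iff)
  ultimately show ?thesis using True by (simp add: power_divide field_simps)
next
  case False
  then show ?thesis using assms by (cases s) (auto simp: binomial_eq_0)
qed

lemma prob_edges_drawn_le:
  assumes "t \<le> card (non_edges n h)" "S \<subseteq> non_edges n h"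
  shows "measure_pmf.prob (kernel_iter (free_step n \<sigma>) t h) {h'. S \<subseteq> fst ` set h'}
     \<le> (real t / real (card (non_edges n h))) ^ card S"
  using prob_edges_drawn[OF assms] binomial_ratio_le[OF assms(1)] by simp

text \<open>Chebyshev's inequality. The indicators of two different drawn edges are non-positively
  correlated, so the variance of the captured weight is at most \<open>q\<close> times the sum of
  the squared weights, where \<open>q\<close> is the fraction drawn. The captured weight has mean
  \<open>q * W\<close>, and a deviation of half the mean gives the factor 4.\<close>

lemma weighted_draw_lower_tail:
  fixes w :: "edge \<Rightarrow> real"
  assumes t: "0 < t" "t \<le> card (non_edges n h)"
    and w: "\<And>f. w f \<ge> 0"
    and W_def: "W = (\<Sum>f\<in>non_edges n h. w f)" and W: "W > 0"
  shows "measure_pmf.prob (kernel_iter (free_step n \<sigma>) t h)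
            {h'. (\<Sum>f\<in>non_edges n h \<inter> fst ` set h'. w f) < real t / real (card (non_edges n h)) * W / 2}
         \<le> 4 * (\<Sum>f\<in>non_edges n h. (w f)\<^sup>2) / (real t / real (card (non_edges n h)) * W\<^sup>2)"
proof -
  let ?E = "non_edges n h"
  let ?M = "measure_pmf (kernel_iter (free_step n \<sigma>) t h)"
  define q where "q = real t / real (card ?E)"
  define I where "I f = (indicator {h'. f \<in> fst ` set h'} :: history \<Rightarrow> real)" for f
  define Y where "Y h' = (\<Sum>f\<in>?E. w f * I f h')" for h'
  define W2 where "W2 = (\<Sum>f\<in>?E. (w f)\<^sup>2)"
  have q: "q > 0" using t by (simp add: q_def)
  have Y: "(\<Sum>f\<in>?E \<inter> fst ` set h'. w f) = Y h'" for h'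
    unfolding Y_def I_def
    by (simp add: sum.inter_restrict if_distrib indicator_def cong: if_cong)
  have int: "integrable ?M (I f)" "integrable ?M (\<lambda>x. I f x * I g x)" for f g
    by (rule measure_pmf.integrable_const_bound[where B = 1]; auto simp: I_def indicator_def)+
  have EI: "integral\<^sup>L ?M (I f) = q" if "f \<in> ?E" for f
    using prob_edges_drawn[of t n h "{f}" \<sigma>] that t by (simp add: I_def q_def)
  \<comment> \<open>Off the diagonal \<open>q^2\<close> suffices by
    \<open>prob_edges_drawn_le\<close>; the extra \<open>q\<close> on the diagonal produces the
    variance term.\<close>
  have EII: "integral\<^sup>L ?M (\<lambda>x. I f x * I g x) \<le> q\<^sup>2 + (if f = g then q else 0)"
    if "f \<in> ?E" "g \<in> ?E" for f g
  proof (cases "f = g")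
    case True
    have "(\<lambda>x. I f x * I g x) = I f" using True by (auto simp: I_def indicator_def)
    then show ?thesis using EI[OF that(1)] True by simp
  next
    case False
    have "(\<lambda>x. I f x * I g x) = indicator {h'. {f, g} \<subseteq> fst ` set h'}"
      by (auto simp: I_def indicator_def fun_eq_iff)
    then have "integral\<^sup>L ?M (\<lambda>x. I f x * I g x) = measure_pmf.prob (kernel_iter (free_step n \<sigma>) t h) {h'. {f, g} \<subseteq> fst ` set h'}"
      by simp
    also have "\<dots> \<le> q ^ card {f, g}"
      unfolding q_def using that t by (intro prob_edges_drawn_le) auto
    finally show ?thesis using False by (simp add: numeral_2_eq_2)
  qed
  have intY: "integrable ?M Y"
    unfolding Y_def by (intro Bochner_Integration.integrable_sum integrable_mult_right int)
  have EY: "integral\<^sup>L ?M Y = q * W"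
    unfolding Y_def W_def by (simp add: int EI sum_distrib_left mult.commute)
  have Ysq: "(Y x)\<^sup>2 = (\<Sum>f\<in>?E. \<Sum>g\<in>?E. w f * w g * (I f x * I g x))" for x
    unfolding Y_def power2_eq_square sum_product by (intro sum.cong) auto
  have intY2: "integrable ?M (\<lambda>x. (Y x)\<^sup>2)"
    unfolding Ysq by (intro Bochner_Integration.integrable_sum integrable_mult_right int)
  have "integral\<^sup>L ?M (\<lambda>x. (Y x)\<^sup>2) = (\<Sum>f\<in>?E. \<Sum>g\<in>?E. w f * w g * integral\<^sup>L ?M (\<lambda>x. I f x * I g x))"
    unfolding Ysq by (simp add: int)
  also have "\<dots> \<le> (\<Sum>f\<in>?E. \<Sum>g\<in>?E. w f * w g * (q\<^sup>2 + (if f = g then q else 0)))"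
    by (intro sum_mono mult_left_mono EII) (auto simp: w)
  also have "\<dots> = (q * W)\<^sup>2 + q * W2"
  proof -
    have "(\<Sum>f\<in>?E. \<Sum>g\<in>?E. w f * w g * (q\<^sup>2 + (if f = g then q else 0)))
        = q\<^sup>2 * (\<Sum>f\<in>?E. \<Sum>g\<in>?E. w f * w g) + (\<Sum>f\<in>?E. \<Sum>g\<in>?E. if f = g then q * (w f)\<^sup>2 else 0)"
      unfolding sum_distrib_left sum.distrib[symmetric]
      by (intro sum.cong refl) (auto simp: algebra_simps power2_eq_square)
    also have "(\<Sum>f\<in>?E. \<Sum>g\<in>?E. w f * w g) = (W)\<^sup>2"
      by (simp add: W_def power2_eq_square sum_product)
    finally show ?thesis
      by (simp add: W2_def sum_distrib_left power_mult_distrib)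
  qed
  finally have EY2: "integral\<^sup>L ?M (\<lambda>x. (Y x)\<^sup>2) \<le> (q * W)\<^sup>2 + q * W2" .
  \<comment> \<open>The centered square in expanded form, so that its integrability and expectation
    follow from those of \<open>Y\<close> and its square.\<close>
  define Z where "Z x = (Y x)\<^sup>2 - 2 * (q * W) * Y x + (q * W)\<^sup>2" for x
  have Z: "Z x = (Y x - q * W)\<^sup>2" for x
    by (simp add: Z_def power2_diff algebra_simps)
  have intZ: "integrable ?M Z"
    unfolding Z_def using intY intY2 by auto
  have EZ: "integral\<^sup>L ?M Z \<le> q * W2"
    unfolding Z_def using intY intY2 EY EY2 by (simp add: power2_eq_square algebra_simps)
  have pos: "q * W > 0" using q W by simp
  have "measure_pmf.prob (kernel_iter (free_step n \<sigma>) t h) {h'. (\<Sum>f\<in>?E \<inter> fst ` set h'. w f) < q * W / 2}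
      \<le> measure_pmf.prob (kernel_iter (free_step n \<sigma>) t h) {x. Z x \<ge> (q * W)\<^sup>2 / 4}"
  proof (rule prob_mono_on_support)
    fix x :: history assume "x \<in> {h'. (\<Sum>f\<in>?E \<inter> fst ` set h'. w f) < q * W / 2}"
    then have "Y x < q * W / 2" by (simp only: Y mem_Collect_eq)
    then have "q * W / 2 \<le> q * W - Y x" by linarith
    then have "(q * W / 2)\<^sup>2 \<le> (q * W - Y x)\<^sup>2" using pos by (intro power_mono) auto
    then show "x \<in> {x. Z x \<ge> (q * W)\<^sup>2 / 4}" by (simp add: Z power2_commute power_divide)
  qed
  also have "\<dots> \<le> integral\<^sup>L ?M Z / ((q * W)\<^sup>2 / 4)"
  proof -
    have "AE x in ?M. 0 \<le> Z x" "0 < (q * W)\<^sup>2 / 4" using q W by (simp_all add: Z)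
    from integral_Markov_inequality_measure[OF intZ _ this, of "{}"] show ?thesis by simp
  qed
  also have "\<dots> \<le> q * W2 / ((q * W)\<^sup>2 / 4)"
    using EZ by (intro divide_right_mono) auto
  also have "\<dots> = 4 * W2 / (q * (W)\<^sup>2)"
    using q W by (simp add: field_simps power2_eq_square)
  finally show ?thesis by (simp add: q_def W2_def)
qed

section \<open>Positions of the deterministic game and their embeddings\<close>

text \<open>All \<open>a\<close> vertices are placed, including those isolated in \<open>h\<close>,
  so that the counts for every position live on the common scale \<open>n^a\<close>. The extensional
  function space makes the set finite.\<close>

definition embeddings :: "nat \<Rightarrow> nat \<Rightarrow> history \<Rightarrow> history \<Rightarrow> (nat \<Rightarrow> nat) set" where
  "embeddings a n h H =
     {\<phi> \<in> {..<a} \<rightarrow>\<^sub>E {..<n}. inj_on \<phi> {..<a} \<and> (\<forall>(e, c) \<in> set h. (\<phi> ` e, c) \<in> set H)}"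

lemma finite_embeddings [simp]: "finite (embeddings a n h H)"
  by (rule finite_subset[of _ "{..<a} \<rightarrow>\<^sub>E {..<n}"]) (auto simp: embeddings_def intro!: finite_PiE)

text \<open>Composing the two maps transfers a loss from the position to the random board. In the
  contrapositive, a position embedded into a board that is not lost is itself not lost, so Builder
  still has a legal move there.\<close>

lemma mono_copy_embedding:
  assumes "mono_copy F a h" "\<phi> \<in> embeddings a n h H"
  shows "mono_copy F n H"
proof -
  from assms(1) obtain c \<psi> where \<psi>: "inj_on \<psi> (uverts F)" "\<psi> ` uverts F \<subseteq> {..<a}"
    "\<forall>e\<in>uedges F. (\<psi> ` e, c) \<in> set h"
    by (auto simp: mono_copy_def board_def)
  have \<phi>: "inj_on \<phi> {..<a}" "\<phi> ` {..<a} \<subseteq> {..<n}" "\<And>e c. (e, c) \<in> set h \<Longrightarrow> (\<phi> ` e, c) \<in> set H"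
    using assms(2) by (auto simp: embeddings_def)
  have "inj_on (\<phi> \<circ> \<psi>) (uverts F)"
    using \<psi> \<phi> by (meson comp_inj_on inj_on_subset)
  moreover have "(\<phi> \<circ> \<psi>) ` uverts F \<subseteq> uverts (board n H)"
    using \<psi> \<phi> by (auto simp: board_def)
  moreover have "\<forall>e\<in>uedges F. ((\<phi> \<circ> \<psi>) ` e, c) \<in> set H"
    using \<psi>(3) \<phi>(3) by (metis image_comp)
  ultimately show ?thesis unfolding mono_copy_def by blast
qed

lemma card_embeddings_Nil:
  assumes "a \<le> n"
  shows "real (card (embeddings a n [] H)) \<ge> (1 / (2 * real a)) ^ a * real n ^ a"
proof (cases "a = 0")
  case False
  \<comment> \<open>Maps sending each \<open>i\<close> into its own block of \<open>n div a\<close> vertices are injective.\<close>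
  define b where "b = n div a"
  let ?B = "\<lambda>i. {i * b..<i * b + b}"
  have ab: "a * b \<le> n" by (simp add: b_def)
  have sub: "(\<Pi>\<^sub>E i\<in>{..<a}. ?B i) \<subseteq> embeddings a n [] H"
  proof
    fix \<phi> assume \<phi>: "\<phi> \<in> (\<Pi>\<^sub>E i\<in>{..<a}. ?B i)"
    have dv: "\<phi> i div b = i \<and> \<phi> i < n" if "i < a" for i
    proof -
      have i: "i * b \<le> \<phi> i" "\<phi> i < i * b + b" using \<phi> that by (auto simp: PiE_def Pi_def)
      have "(i + 1) * b \<le> a * b" using that by (intro mult_right_mono) auto
      then have "\<phi> i < n" using i ab by simp
      moreover have "\<phi> i div b = i"
        using i by (intro div_nat_eqI) (auto simp: algebra_simps)
      ultimately show ?thesis by simp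
    qed
    have "inj_on \<phi> {..<a}" by (rule inj_onI) (metis dv lessThan_iff)
    then show "\<phi> \<in> embeddings a n [] H"
      using \<phi> dv by (auto simp: embeddings_def PiE_def Pi_def)
  qed
  \<comment> \<open>As \<open>a \<le> n\<close>, the blocks are nonempty, so rounding down costs at
    most a factor 2: \<open>n < a * b + a \<le> 2 * a * b\<close>.\<close>
  have "real n / (2 * real a) \<le> real b"
  proof -
    have "n < a * b + a" using False by (simp add: b_def dividend_less_times_div add.commute)
    moreover have "b \<ge> 1" using assms False by (simp add: b_def Suc_leI div_greater_zero_iff)
    then have "a \<le> a * b" by simp
    ultimately have "n \<le> 2 * a * b" by linarith
    then have "real n \<le> 2 * real a * real b" by (metis of_nat_le_iff of_nat_mult of_nat_numeral)
    then show ?thesis using False by (simp add: field_simps)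
  qed
  then have "(real n / (2 * real a)) ^ a \<le> real b ^ a"
    by (intro power_mono) auto
  also have "\<dots> = real (card (\<Pi>\<^sub>E i\<in>{..<a}. ?B i))"
    by (simp add: card_PiE)
  also have "\<dots> \<le> real (card (embeddings a n [] H))"
    using sub by (simp add: card_mono)
  finally show ?thesis by (simp add: power_divide)
next
  case True
  then have "embeddings a n [] H = {\<lambda>_. undefined}" by (auto simp: embeddings_def)
  then show ?thesis using True by simp
qed

section \<open>Reachable positions and the density restriction\<close>

text \<open>The positions reached when Builder follows \<open>\<beta>\<close> and every answer of
  Painter is allowed. Fixing no Painter strategy lets the random board decide the colors; play may
  continue past a monochromatic copy.\<close>

inductive legal_play :: "(history \<Rightarrow> edge) \<Rightarrow> nat \<Rightarrow> nat \<Rightarrow> real \<Rightarrow> history \<Rightarrow> bool"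
  for \<beta> r a d where
  Nil: "legal_play \<beta> r a d []"
| snoc: "legal_play \<beta> r a d h \<Longrightarrow> legal_move a d h (\<beta> h) \<Longrightarrow> c < r \<Longrightarrow>
    legal_play \<beta> r a d (h @ [(\<beta> h, c)])"

lemma legal_play_edges:
  "legal_play \<beta> r a d h \<Longrightarrow> distinct (map fst h) \<and> fst ` set h \<subseteq> [{..<a}]\<^bsup>2\<^esup>"
  by (induction rule: legal_play.induct) (auto simp: legal_move_def non_edges_def board_def)

lemma card_legal_play_edges:
  "legal_play \<beta> r a d h \<Longrightarrow> card (fst ` set h) = length h"
  using legal_play_edges[of \<beta> r a d h] distinct_card[of "map fst h"] by simp

lemma length_legal_play:
  assumes "legal_play \<beta> r a d h"
  shows "length h \<le> a choose 2"
  using card_mono[of "[{..<a}]\<^bsup>2\<^esup>" "fst ` set h"] legal_play_edges[OF assms] card_legal_play_edges[OF assms]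
  by (simp add: finite_imp_finite_nsets)

text \<open>Allows a union bound over positions: their number is independent of
  \<open>n\<close>.\<close>

lemma finite_legal_play: "finite {h. legal_play \<beta> r a d h \<and> length h = k}"
proof (induction k)
  case (Suc k)
  have "{h. legal_play \<beta> r a d h \<and> length h = Suc k}
    \<subseteq> (\<lambda>(h, c). h @ [(\<beta> h, c)]) ` ({h. legal_play \<beta> r a d h \<and> length h = k} \<times> {..<r})"
  proof
    fix h assume "h \<in> {h. legal_play \<beta> r a d h \<and> length h = Suc k}"
    then have h: "legal_play \<beta> r a d h" "length h = Suc k" by auto
    from h(1) show "h \<in> (\<lambda>(h, c). h @ [(\<beta> h, c)]) ` ({h. legal_play \<beta> r a d h \<and> length h = k} \<times> {..<r})"
      by cases (use h(2) in force)+
  qed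
  then show ?case using Suc finite_subset by blast
qed simp

lemma legal_play_nth:
  "legal_play \<beta> r a d h \<Longrightarrow> j < length h \<Longrightarrow>
    fst (h ! j) = \<beta> (take j h) \<and> snd (h ! j) < r"
proof (induction arbitrary: j rule: legal_play.induct)
  case (snoc h c)
  show ?case
  proof (cases "j < length h")
    case True
    with snoc.IH[OF True] show ?thesis by (simp add: nth_append)
  next
    case False
    then have "j = length h" using snoc.prems by simp
    then show ?thesis using snoc.hyps by simp
  qed
qed simp

lemma winning_strategy_legal:
  assumes win: "\<And>\<pi>. (\<forall>h e. \<pi> h e < r) \<Longrightarrow>
          (\<exists>k. (\<forall>j<k. legal_move a d (det_play \<beta> \<pi> j) (\<beta> (det_play \<beta> \<pi> j))) \<and>
               mono_copy F a (det_play \<beta> \<pi> k))"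
    and r: "0 < r" and h: "legal_play \<beta> r a d h" and nm: "\<not> mono_copy F a h"
  shows "legal_move a d h (\<beta> h)"
proof -
  \<comment> \<open>Painter replays the colors of \<open>h\<close>, so Builder cannot have won before leaving \<open>h\<close>.\<close>
  define \<pi> where "\<pi> h' e = (if length h' < length h then snd (h ! length h') else 0)"
    for h' :: history and e :: edge
  have "\<forall>h e. \<pi> h e < r" using legal_play_nth[OF h] r by (simp add: \<pi>_def)
  from win[OF this] obtain k where
    k: "\<And>j. j < k \<Longrightarrow> legal_move a d (det_play \<beta> \<pi> j) (\<beta> (det_play \<beta> \<pi> j))"
      "mono_copy F a (det_play \<beta> \<pi> k)" by blast
  have play: "det_play \<beta> \<pi> j = take j h" if "j \<le> length h" for j
    using that
  proof (induction j)
    case (Suc j)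
    then have "det_play \<beta> \<pi> j = take j h" by simp
    moreover have "h ! j = (\<beta> (take j h), \<pi> (take j h) (\<beta> (take j h)))"
      using legal_play_nth[OF h, of j] Suc.prems by (auto simp: prod_eq_iff \<pi>_def)
    ultimately show ?case using Suc.prems
      by (simp add: take_Suc_conv_app_nth Let_def)
  qed simp
  have "length h < k"
  proof (rule ccontr)
    assume "\<not> length h < k"
    then have "mono_copy F a (take k h)" using k(2) play[of k] by simp
    then show False using nm mono_copy_mono[of F a "take k h" h] set_take_subset[of k h] by blast
  qed
  then show ?thesis using k(1)[of "length h"] play[of "length h"] by simp
qed

text \<open>The density ratios form a finite set, being indexed by subsets of finite sets, so
  \<open>Max\<close> dominates the ratio of each single subgraph.\<close>

lemma density_bound:
  assumes e: "legal_move a d h e"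
    and h: "fst ` set h \<subseteq> [{..<a}]\<^bsup>2\<^esup>"
    and V: "V \<subseteq> {..<a}" "V \<noteq> {}" and D: "D \<subseteq> insert e (fst ` set h)" "D \<subseteq> [V]\<^bsup>2\<^esup>"
  shows "real (card D) \<le> d * real (card V)"
proof -
  let ?G = "(uverts (board a h), insert e (uedges (board a h)))"
  let ?S = "{real (card (uedges H)) / real (card (uverts H)) | H. subgraph H ?G \<and> uverts H \<noteq> {}}"
  have fV: "finite V" using V(1) finite_subset by blast
  have "?S \<subseteq> (\<lambda>H. real (card (uedges H)) / real (card (uverts H))) `
      (Pow {..<a} \<times> Pow (insert e (fst ` set h)))"
    by (auto simp: subgraph_def board_def intro!: image_eqI)
  then have "finite ?S" by (rule finite_subset) auto
  moreover have "subgraph (V, D) ?G"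
    using V D fV by (auto simp: subgraph_def simple_graph_def board_def)
  then have "real (card D) / real (card V) \<in> ?S" using V(2) by force
  ultimately have "real (card D) / real (card V) \<le> max_density ?G"
    unfolding max_density_def by (rule Max_ge)
  also have "\<dots> \<le> d" using e by (simp add: legal_move_def)
  finally show ?thesis using V(2) fV by (simp add: field_simps card_gt_0_iff)
qed

section \<open>Expected numbers of copies and of overlapping pairs\<close>

abbreviation injections :: "nat \<Rightarrow> nat \<Rightarrow> (nat \<Rightarrow> nat) set" where
  "injections a n \<equiv> {\<phi> \<in> {..<a} \<rightarrow>\<^sub>E {..<n}. inj_on \<phi> {..<a}}"

lemma finite_injections [simp]: "finite (injections a n)"
  by (rule finite_subset[of _ "{..<a} \<rightarrow>\<^sub>E {..<n}"]) (auto intro!: finite_PiE)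

lemma card_injections_le: "card (injections a n) \<le> n ^ a"
proof -
  have "card (injections a n) \<le> card ({..<a} \<rightarrow>\<^sub>E {..<n})"
    by (intro card_mono finite_PiE) auto
  then show ?thesis by (simp add: card_PiE)
qed

lemma injection_nsets:
  assumes "\<phi> \<in> injections a n" "e \<in> [{..<a}]\<^bsup>2\<^esup>"
  shows "\<phi> ` e \<in> [{..<n}]\<^bsup>2\<^esup>"
proof -
  have "inj_on \<phi> {..<a}" "\<phi> ` {..<a} \<subseteq> {..<n}" using assms by auto
  then show ?thesis using assms(2)
    by (auto simp: nsets_def card_image inj_on_subset)
qed

lemma card_image_edges:
  assumes "\<phi> \<in> injections a n" "E \<subseteq> [{..<a}]\<^bsup>2\<^esup>"
  shows "card ((`) \<phi> ` E) = card E"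
  using assms by (intro card_image inj_on_subset[OF inj_on_nsets]) auto

text \<open>Replaces the true fraction of edges drawn so far by an upper bound \<open>p\<close> that
  is common to all rounds.\<close>

lemma prob_edges_drawn_le_power:
  assumes "t \<le> n choose 2" "real t \<le> p * real (n choose 2)" "p \<ge> 0" "S \<subseteq> [{..<n}]\<^bsup>2\<^esup>"
  shows "measure_pmf.prob (kernel_iter (free_step n \<sigma>) t []) {H. S \<subseteq> fst ` set H} \<le> p ^ card S"
proof -
  have E: "non_edges n [] = [{..<n}]\<^bsup>2\<^esup>" by (simp add: non_edges_def board_def)
  have "measure_pmf.prob (kernel_iter (free_step n \<sigma>) t []) {H. S \<subseteq> fst ` set H}
      \<le> (real t / real (n choose 2)) ^ card S"
    using prob_edges_drawn_le[of t n "[]" S \<sigma>] assms by (simp add: E)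
  also have "\<dots> \<le> p ^ card S"
    using assms by (intro power_mono) (auto simp: divide_le_eq)
  finally show ?thesis .
qed

text \<open>First moment over all injections. In the application \<open>D\<close> is a
  \<open>k\<close>-step position together with Builder's next edge, which makes the bound smaller by
  a factor \<open>p\<close> than the scale \<open>n^a * p^k\<close> of the copies.\<close>

lemma expected_closed_copies:
  assumes t: "t \<le> n choose 2" "real t \<le> p * real (n choose 2)" "p \<ge> 0"
    and D: "D \<subseteq> [{..<a}]\<^bsup>2\<^esup>"
  shows "(\<Sum>\<phi>\<in>injections a n. measure_pmf.prob (kernel_iter (free_step n \<sigma>) t [])
           {H. (`) \<phi> ` D \<subseteq> fst ` set H}) \<le> real n ^ a * p ^ card D"
proof -
  have "(\<Sum>\<phi>\<in>injections a n. measure_pmf.prob (kernel_iter (free_step n \<sigma>) t [])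
           {H. (`) \<phi> ` D \<subseteq> fst ` set H}) \<le> (\<Sum>\<phi>\<in>injections a n. p ^ card D)"
  proof (intro sum_mono)
    fix \<phi> assume \<phi>: "\<phi> \<in> injections a n"
    have "(`) \<phi> ` D \<subseteq> [{..<n}]\<^bsup>2\<^esup>" using injection_nsets[OF \<phi>] D by blast
    from prob_edges_drawn_le_power[OF t this, of \<sigma>]
    show "measure_pmf.prob (kernel_iter (free_step n \<sigma>) t []) {H. (`) \<phi> ` D \<subseteq> fst ` set H} \<le> p ^ card D"
      by (simp only: card_image_edges[OF \<phi> D])
  qed
  also have "\<dots> = real (card (injections a n)) * p ^ card D" by simp
  also have "\<dots> \<le> real n ^ a * p ^ card D"
  proof (intro mult_right_mono)
    show "real (card (injections a n)) \<le> real n ^ a"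
      using card_injections_le[of a n] by (metis of_nat_le_iff of_nat_power)
  qed (use t in auto)
  finally show ?thesis .
qed

text \<open>The two copies span \<open>2 * length h\<close> minus the number of shared edges. The
  shared edges together with \<open>e\<close>, which is not yet in the position, form a subgraph on
  the shared vertices, so their number plus one is at most \<open>d\<close> times the number of
  shared vertices. As \<open>p \<le> 1\<close>, this lower bound on the exponent bounds the power
  from above.\<close>

lemma overlap_bound:
  assumes h: "legal_play \<beta> r a d h" and e: "legal_move a d h e"
    and \<phi>: "\<phi> \<in> injections a n" and \<psi>: "\<psi> \<in> injections a n" and eq: "\<phi> ` e = \<psi> ` e"
    and p: "0 < p" "p \<le> 1"
  defines "E \<equiv> fst ` set h"
  shows "p ^ card ((`) \<phi> ` E \<union> (`) \<psi> ` E)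
    \<le> p ^ (2 * length h + 1) * (p powr (- d)) ^ card {u \<in> {..<a}. \<psi> u \<in> \<phi> ` {..<a}}"
proof -
  let ?V = "{u \<in> {..<a}. \<psi> u \<in> \<phi> ` {..<a}}"
  \<comment> \<open>\<open>?V\<close> and \<open>?J\<close> form the overlap of the two copies, pulled back along \<open>\<psi>\<close>; the density
    restriction applies to it together with \<open>e\<close>.\<close>
  let ?J = "{x \<in> E. \<psi> ` x \<in> (`) \<phi> ` E}"
  have E: "E \<subseteq> [{..<a}]\<^bsup>2\<^esup>" "card E = length h" "finite E"
    using legal_play_edges[OF h] card_legal_play_edges[OF h] by (auto simp: E_def)
  have e2: "e \<in> [{..<a}]\<^bsup>2\<^esup>" "e \<notin> E"
    using e by (auto simp: legal_move_def non_edges_def board_def E_def)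
  have sub: "x \<subseteq> {..<a}" "card x = 2" if "x \<in> insert e E" for x
    using that E(1) e2(1) by (auto simp: nsets_def)
  have "insert e ?J \<subseteq> [?V]\<^bsup>2\<^esup>"
  proof
    fix x assume x: "x \<in> insert e ?J"
    then obtain y where y: "y \<in> insert e E" "\<psi> ` x = \<phi> ` y" using eq[symmetric] by blast
    have "\<psi> u \<in> \<phi> ` {..<a}" if "u \<in> x" for u
      using y sub(1)[OF y(1)] that by blast
    then have "x \<subseteq> ?V" using sub(1)[of x] x by auto
    moreover have "finite x" using sub(2)[of x] x by (metis (lifting) card.infinite insert_iff mem_Collect_eq zero_neq_numeral)
    ultimately show "x \<in> [?V]\<^bsup>2\<^esup>" using sub(2)[of x] x by (auto simp: nsets_def)
  qed
  moreover have "?V \<noteq> {}"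
  proof -
    have "e \<noteq> {}" using sub(2)[of e] by auto
    then show ?thesis using sub(1)[of e] eq by blast
  qed
  ultimately have "real (card (insert e ?J)) \<le> d * real (card ?V)"
    using E e by (intro density_bound[of a d h e ?V]) (auto simp: E_def)
  then have J: "real (card ?J) + 1 \<le> d * real (card ?V)"
    using e2 E(3) by simp
  have "(`) \<phi> ` E \<inter> (`) \<psi> ` E = (`) \<psi> ` ?J" by blast
  moreover have "?J \<subseteq> [{..<a}]\<^bsup>2\<^esup>" using E(1) by auto
  ultimately have "card ((`) \<phi> ` E \<inter> (`) \<psi> ` E) = card ?J"
    by (simp only: card_image_edges[OF \<psi>])
  then have un: "card ((`) \<phi> ` E \<union> (`) \<psi> ` E) + card ?J = 2 * length h"
    using card_Un_Int[of "(`) \<phi> ` E" "(`) \<psi> ` E"] E card_image_edges[OF \<phi> E(1)] card_image_edges[OF \<psi> E(1)]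
    by simp
  have "p ^ card ((`) \<phi> ` E \<union> (`) \<psi> ` E) = p powr (real (card ((`) \<phi> ` E \<union> (`) \<psi> ` E)))"
    using p by (simp add: powr_realpow)
  also have "\<dots> \<le> p powr (real (2 * length h + 1) + - d * real (card ?V))"
  proof (rule powr_mono')
    have "real (card ((`) \<phi> ` E \<union> (`) \<psi> ` E)) + real (card ?J) = 2 * real (length h)"
      unfolding of_nat_add[symmetric] un by simp
    then show "real (2 * length h + 1) + - d * real (card ?V) \<le> real (card ((`) \<phi> ` E \<union> (`) \<psi> ` E))"
      using J by simp
  qed (use p in auto)
  also have "\<dots> = p powr real (2 * length h + 1) * (p powr (- d)) powr real (card ?V)"
    by (simp only: powr_add powr_powr)
  also have "\<dots> = p ^ (2 * length h + 1) * (p powr (- d)) ^ card ?V"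
    using p by (simp only: powr_realpow powr_gt_zero)
  finally show ?thesis .
qed

text \<open>Without injectivity the sum factorizes over the coordinates: \<open>u0\<close>
  contributes \<open>card P * q\<close>, and every other coordinate at most
  \<open>n + card P * q\<close>.\<close>

lemma sum_power_hits_le:
  fixes q :: real
  assumes P: "P \<subseteq> {..<n}" "card P \<le> a" and u0: "u0 < a" and q: "q \<ge> 0"
  shows "(\<Sum>\<psi>\<in>{\<psi> \<in> {..<a} \<rightarrow>\<^sub>E {..<n}. \<psi> u0 \<in> P}. q ^ card {u \<in> {..<a}. \<psi> u \<in> P})
    \<le> real a * q * (real n + real a * q) ^ (a - 1)"
proof -
  define g where "g y = (if y \<in> P then q else 1)" for y
  define B where "B u = (if u = u0 then P else {..<n})" for u
  have fP: "finite P" using P(1) finite_subset by blast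
  have aq: "real (card P) * q \<le> real a * q" using P(2) q by (intro mult_right_mono) auto
  have "{\<psi> \<in> {..<a} \<rightarrow>\<^sub>E {..<n}. \<psi> u0 \<in> P} = PiE {..<a} B"
    using P(1) u0 by (auto simp: B_def PiE_def Pi_def split: if_splits)
  moreover have "q ^ card {u \<in> {..<a}. \<psi> u \<in> P} = (\<Prod>u<a. g (\<psi> u))" for \<psi>
  proof -
    have "{u \<in> {..<a}. \<psi> u \<in> P} = {..<a} \<inter> {u. \<psi> u \<in> P}" by auto
    then show ?thesis by (simp add: g_def prod.If_cases)
  qed
  ultimately have "(\<Sum>\<psi>\<in>{\<psi> \<in> {..<a} \<rightarrow>\<^sub>E {..<n}. \<psi> u0 \<in> P}. q ^ card {u \<in> {..<a}. \<psi> u \<in> P})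
      = (\<Sum>\<psi>\<in>PiE {..<a} B. \<Prod>u<a. g (\<psi> u))" by simp
  also have "\<dots> = (\<Prod>u<a. \<Sum>y\<in>B u. g y)"
    using fP by (subst prod_sum_PiE) (auto simp: B_def)
  also have "\<dots> = (\<Sum>y\<in>P. g y) * (\<Prod>u\<in>{..<a} - {u0}. \<Sum>y<n. g y)"
    using u0 by (subst prod.remove[of _ u0]) (auto simp: B_def intro!: arg_cong2[where f = "(*)"] prod.cong)
  also have "\<dots> = real (card P) * q * (\<Sum>y<n. g y) ^ (a - 1)"
    using u0 by (simp add: g_def)
  also have "\<dots> \<le> real a * q * (real n + real a * q) ^ (a - 1)"
  proof (intro mult_mono power_mono)
    have "(\<Sum>y<n. g y) \<le> (\<Sum>y<n. 1 + (if y \<in> P then q else 0))"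
      using q by (intro sum_mono) (auto simp: g_def)
    also have "\<dots> = real n + real (card P) * q"
    proof -
      have "{..<n} \<inter> {y. y \<in> P} = P" using P(1) by auto
      then show ?thesis by (simp add: sum.distrib sum.If_cases)
    qed
    finally show "(\<Sum>y<n. g y) \<le> real n + real a * q" using aq by simp
    show "0 \<le> (\<Sum>y<n. g y)" using q by (intro sum_nonneg) (auto simp: g_def)
    then show "0 \<le> (\<Sum>y<n. g y) ^ (a - 1)" by simp
  qed (use P aq q in auto)
  finally show ?thesis .
qed

text \<open>For fixed \<open>\<phi>\<close>, the maps \<open>\<psi>\<close> are weighted by
  \<open>p powr (- d)\<close> for each vertex that meets the image of \<open>\<phi>\<close>.
  Agreement on \<open>e\<close> forces at least one such vertex, which saves a factor
  \<open>p powr (- d) / n\<close>; the assumption on \<open>a * p powr (- d)\<close> keeps the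
  remaining coordinates at \<open>2 * n\<close> each.\<close>

lemma expected_overlapping_pairs:
  assumes h: "legal_play \<beta> r a d h" and e: "legal_move a d h e"
    and p: "0 < p" "p \<le> 1" and n: "0 < n" "real a * p powr (- d) \<le> real n"
    and t: "t \<le> n choose 2" "real t \<le> p * real (n choose 2)"
  defines "E \<equiv> fst ` set h"
  shows "(\<Sum>\<phi>\<in>injections a n. \<Sum>\<psi>\<in>{\<psi> \<in> injections a n. \<phi> ` e = \<psi> ` e}.
           measure_pmf.prob (kernel_iter (free_step n \<sigma>) t []) {H. (`) \<phi> ` E \<union> (`) \<psi> ` E \<subseteq> fst ` set H})
    \<le> real a * 2 ^ a * p ^ (2 * length h + 1) * real n ^ (2 * a) * (p powr (- d) / real n)"
proof -
  define q where "q = p powr (- d)"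
  have q: "q \<ge> 0" by (simp add: q_def)
  have E: "E \<subseteq> [{..<a}]\<^bsup>2\<^esup>" using legal_play_edges[OF h] by (auto simp: E_def)
  have "e \<in> [{..<a}]\<^bsup>2\<^esup>" using e by (auto simp: legal_move_def non_edges_def)
  then obtain u0 where u0: "u0 \<in> e" "u0 < a" and ea: "e \<subseteq> {..<a}" by (auto elim!: nsets2_E)
  have inner: "(\<Sum>\<psi>\<in>{\<psi> \<in> injections a n. \<phi> ` e = \<psi> ` e}.
           measure_pmf.prob (kernel_iter (free_step n \<sigma>) t []) {H. (`) \<phi> ` E \<union> (`) \<psi> ` E \<subseteq> fst ` set H})
        \<le> p ^ (2 * length h + 1) * (real a * q * (2 * real n) ^ (a - 1))"
    if \<phi>: "\<phi> \<in> injections a n" for \<phi>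
  proof -
    let ?P = "\<phi> ` {..<a}"
    have P: "?P \<subseteq> {..<n}" "card ?P \<le> a"
      using \<phi> card_image_le[of "{..<a}" \<phi>] by auto
    have "(\<Sum>\<psi>\<in>{\<psi> \<in> injections a n. \<phi> ` e = \<psi> ` e}.
           measure_pmf.prob (kernel_iter (free_step n \<sigma>) t []) {H. (`) \<phi> ` E \<union> (`) \<psi> ` E \<subseteq> fst ` set H})
        \<le> (\<Sum>\<psi>\<in>{\<psi> \<in> injections a n. \<phi> ` e = \<psi> ` e}. p ^ (2 * length h + 1) * q ^ card {u \<in> {..<a}. \<psi> u \<in> ?P})"
    proof (intro sum_mono)
      fix \<psi> assume "\<psi> \<in> {\<psi> \<in> injections a n. \<phi> ` e = \<psi> ` e}"
      then have \<psi>: "\<psi> \<in> injections a n" "\<phi> ` e = \<psi> ` e" by auto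
      have "(`) \<phi> ` E \<union> (`) \<psi> ` E \<subseteq> [{..<n}]\<^bsup>2\<^esup>"
        using injection_nsets[OF \<phi>] injection_nsets[OF \<psi>(1)] E by blast
      from prob_edges_drawn_le_power[OF t _ this, of \<sigma>] overlap_bound[OF h e \<phi> \<psi> p]
      show "measure_pmf.prob (kernel_iter (free_step n \<sigma>) t []) {H. (`) \<phi> ` E \<union> (`) \<psi> ` E \<subseteq> fst ` set H}
        \<le> p ^ (2 * length h + 1) * q ^ card {u \<in> {..<a}. \<psi> u \<in> ?P}"
        using p by (simp add: E_def q_def)
    qed
    \<comment> \<open>Injectivity and the condition on \<open>e\<close> are weakened to the single
      requirement that the endpoint \<open>u0\<close> of \<open>e\<close> lands in the image of
      \<open>\<phi>\<close>.\<close>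
    also have "\<dots> \<le> (\<Sum>\<psi>\<in>{\<psi> \<in> {..<a} \<rightarrow>\<^sub>E {..<n}. \<psi> u0 \<in> ?P}. p ^ (2 * length h + 1) * q ^ card {u \<in> {..<a}. \<psi> u \<in> ?P})"
    proof (intro sum_mono2)
      show "finite {\<psi> \<in> {..<a} \<rightarrow>\<^sub>E {..<n}. \<psi> u0 \<in> ?P}"
        by (rule finite_subset[of _ "{..<a} \<rightarrow>\<^sub>E {..<n}"]) (auto intro!: finite_PiE)
      show "{\<psi> \<in> injections a n. \<phi> ` e = \<psi> ` e} \<subseteq> {\<psi> \<in> {..<a} \<rightarrow>\<^sub>E {..<n}. \<psi> u0 \<in> ?P}"
        using u0 ea by blast
    qed (use p q in auto)
    also have "\<dots> \<le> p ^ (2 * length h + 1) * (real a * q * (real n + real a * q) ^ (a - 1))"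
      unfolding sum_distrib_left[symmetric]
      using sum_power_hits_le[OF P u0(2) q] p by (intro mult_left_mono) auto
    also have "\<dots> \<le> p ^ (2 * length h + 1) * (real a * q * (2 * real n) ^ (a - 1))"
      using p q n by (intro mult_left_mono power_mono) (auto simp: q_def)
    finally show ?thesis .
  qed
  have "(\<Sum>\<phi>\<in>injections a n. \<Sum>\<psi>\<in>{\<psi> \<in> injections a n. \<phi> ` e = \<psi> ` e}.
           measure_pmf.prob (kernel_iter (free_step n \<sigma>) t []) {H. (`) \<phi> ` E \<union> (`) \<psi> ` E \<subseteq> fst ` set H})
      \<le> real (card (injections a n)) * (p ^ (2 * length h + 1) * (real a * q * (2 * real n) ^ (a - 1)))"
    by (rule sum_bounded_above) (rule inner)
  also have "\<dots> \<le> real n ^ a * (p ^ (2 * length h + 1) * (real a * q * (2 * real n) ^ (a - 1)))"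
  proof (intro mult_right_mono)
    show "real (card (injections a n)) \<le> real n ^ a"
      using card_injections_le[of a n] by (metis of_nat_le_iff of_nat_power)
  qed (use p q in auto)
  also have "\<dots> \<le> real n ^ a * (p ^ (2 * length h + 1) * (real a * q * (2 ^ a * real n ^ a / real n)))"
  proof (intro mult_left_mono)
    obtain b where b: "a = Suc b" using u0 by (cases a) auto
    show "(2 * real n) ^ (a - 1) \<le> 2 ^ a * real n ^ a / real n"
      using n by (simp add: b power_mult_distrib)
  qed (use p q in auto)
  also have "\<dots> = real a * 2 ^ a * p ^ (2 * length h + 1) * real n ^ (2 * a) * (p powr (- d) / real n)"
    by (simp only: q_def mult_2 power_add) (simp add: mult_ac)
  finally show ?thesis .
qed

section \<open>One round\<close>

lemma sum_card_fibers:
  assumes "finite A" "finite B"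
  shows "(\<Sum>f\<in>B. card {x \<in> A. g x = f}) = card {x \<in> A. g x \<in> B}"
proof -
  have "(\<Sum>f\<in>B. card {x \<in> A. g x = f}) = (\<Sum>f\<in>B. \<Sum>x\<in>{x \<in> {x \<in> A. g x \<in> B}. g x = f}. 1)"
    by (intro sum.cong) (auto intro!: arg_cong[where f = card])
  also have "\<dots> = (\<Sum>x\<in>{x \<in> A. g x \<in> B}. 1)"
    using assms by (intro sum.group) auto
  finally show ?thesis by simp
qed

text \<open>A squared fiber size counts ordered pairs in that fiber. This turns the sum of squared
  edge weights into a count of pairs of copies that agree on the next edge.\<close>

lemma sum_card_fibers_square_le:
  assumes "finite A" "finite B"
  shows "(\<Sum>f\<in>B. (real (card {x \<in> A. g x = f}))\<^sup>2) \<le> (\<Sum>x\<in>A. real (card {y \<in> A. g x = g y}))"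
proof -
  have "(\<Sum>f\<in>B. (real (card {x \<in> A. g x = f}))\<^sup>2)
      = (\<Sum>f\<in>B. \<Sum>x\<in>{x \<in> {x \<in> A. g x \<in> B}. g x = f}. real (card {y \<in> A. g x = g y}))"
  proof (rule sum.cong)
    fix f assume f: "f \<in> B"
    have "(\<Sum>x\<in>{x \<in> {x \<in> A. g x \<in> B}. g x = f}. real (card {y \<in> A. g x = g y}))
        = (\<Sum>x\<in>{x \<in> A. g x = f}. real (card {y \<in> A. g y = f}))"
      using f by (intro sum.cong) (auto intro!: arg_cong[where f = card])
    then show "(real (card {x \<in> A. g x = f}))\<^sup>2
        = (\<Sum>x\<in>{x \<in> {x \<in> A. g x \<in> B}. g x = f}. real (card {y \<in> A. g x = g y}))"
      by (simp add: power2_eq_square)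
  qed simp
  also have "\<dots> = (\<Sum>x\<in>{x \<in> A. g x \<in> B}. real (card {y \<in> A. g x = g y}))"
    using assms by (intro sum.group) auto
  also have "\<dots> \<le> (\<Sum>x\<in>A. real (card {y \<in> A. g x = g y}))"
    using assms by (intro sum_mono2) auto
  finally show ?thesis .
qed

text \<open>A copy whose next edge was free in \<open>H\<close> and has since been drawn finds that
  edge in \<open>s\<close>; whichever color \<open>c < r\<close> it received, the copy extends to
  the position with that color.\<close>

lemma extended_embeddings_ge:
  assumes "snd ` set s \<subseteq> {..<r}"
  shows "(\<Sum>f\<in>non_edges n H \<inter> fst ` set (H @ s). real (card {\<phi> \<in> embeddings a n h H. \<phi> ` e = f}))
    \<le> (\<Sum>c<r. real (card (embeddings a n (h @ [(e, c)]) (H @ s))))"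
proof -
  let ?B = "non_edges n H \<inter> fst ` set (H @ s)"
  have "{\<phi> \<in> embeddings a n h H. \<phi> ` e \<in> ?B} \<subseteq> (\<Union>c<r. embeddings a n (h @ [(e, c)]) (H @ s))"
  proof
    fix \<phi> assume "\<phi> \<in> {\<phi> \<in> embeddings a n h H. \<phi> ` e \<in> ?B}"
    then have \<phi>: "\<phi> \<in> embeddings a n h H" "\<phi> ` e \<in> ?B" by auto
    then have "\<phi> ` e \<in> fst ` set s" by (auto simp: non_edges_def board_def)
    then obtain c where c: "(\<phi> ` e, c) \<in> set s" by auto
    then have "c < r" using assms by force
    moreover have "\<phi> \<in> embeddings a n (h @ [(e, c)]) (H @ s)"
      using \<phi>(1) c by (auto simp: embeddings_def)
    ultimately show "\<phi> \<in> (\<Union>c<r. embeddings a n (h @ [(e, c)]) (H @ s))" by blast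
  qed
  then have "card {\<phi> \<in> embeddings a n h H. \<phi> ` e \<in> ?B} \<le> card (\<Union>c<r. embeddings a n (h @ [(e, c)]) (H @ s))"
    by (intro card_mono) auto
  also have "\<dots> \<le> (\<Sum>c<r. card (embeddings a n (h @ [(e, c)]) (H @ s)))"
    by (rule card_UN_le) simp
  finally have "(\<Sum>f\<in>?B. card {\<phi> \<in> embeddings a n h H. \<phi> ` e = f})
      \<le> (\<Sum>c<r. card (embeddings a n (h @ [(e, c)]) (H @ s)))"
    using sum_card_fibers[of "embeddings a n h H" ?B "\<lambda>\<phi>. \<phi> ` e"] by simp
  then show ?thesis by (simp only: of_nat_sum[symmetric] of_nat_le_iff)
qed

lemma binomial2_bounds:
  assumes "2 \<le> n"
  shows "real n ^ 2 / 4 \<le> real (n choose 2)" "real (n choose 2) \<le> real n ^ 2"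
proof -
  have "real (n choose 2) = real n * (real n - 1) / 2"
    using assms by (simp add: choose_two real_of_nat_div of_nat_diff)
  moreover have "2 * real n \<le> real n * real n" using assms by (intro mult_right_mono) auto
  ultimately show "real n ^ 2 / 4 \<le> real (n choose 2)" "real (n choose 2) \<le> real n ^ 2"
    by (simp_all add: power2_eq_square field_simps)
qed

lemma embeddings_injections: "embeddings a n h H \<subseteq> injections a n"
  by (auto simp: embeddings_def)

lemma embeddings_edges:
  assumes "\<phi> \<in> embeddings a n h H"
  shows "(`) \<phi> ` (fst ` set h) \<subseteq> fst ` set H"
proof
  fix x assume "x \<in> (`) \<phi> ` (fst ` set h)"
  then obtain e c where "(e, c) \<in> set h" "x = \<phi> ` e" by auto
  then have "(x, c) \<in> set H" using assms by (auto simp: embeddings_def)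
  then show "x \<in> fst ` set H" by force
qed

text \<open>The weight of a non-edge is the number of copies whose next edge it is. Fewer than half
  of \<open>\<Gamma>\<close> copies are closed, so the total weight is at least
  \<open>\<Gamma> / 2\<close>. If all colors fall short, the captured weight is below half its mean,
  and \<open>weighted_draw_lower_tail\<close> applies; 16 is its 4 times the square of 2.\<close>

lemma failing_round_le:
  assumes \<sigma>: "online_painter r \<sigma>" and r: "0 < r"
    and L: "0 < L" "L \<le> card (non_edges n H)" and n: "2 \<le> n"
    and e: "e \<in> [{..<a}]\<^bsup>2\<^esup>"
    and \<Gamma>: "0 < \<Gamma>" "\<Gamma> \<le> real (card (embeddings a n h H))"
    and closed: "real (card {\<phi> \<in> embeddings a n h H. \<phi> ` e \<in> fst ` set H}) < \<Gamma> / 2"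
  shows "measure_pmf.prob (kernel_iter (free_step n \<sigma>) L H)
      {H'. \<forall>c<r. real (card (embeddings a n (h @ [(e, c)]) H')) < real L / real n ^ 2 * \<Gamma> / (4 * real r)}
    \<le> 16 / (real L / real n ^ 2 * \<Gamma>\<^sup>2) *
       (\<Sum>\<phi>\<in>embeddings a n h H. real (card {\<psi> \<in> embeddings a n h H. \<phi> ` e = \<psi> ` e}))"
proof -
  let ?E = "non_edges n H" and ?A = "embeddings a n h H"
  define w where "w f = real (card {\<phi> \<in> ?A. \<phi> ` e = f})" for f
  define W where "W = (\<Sum>f\<in>?E. w f)"
  define Z where "Z = (\<Sum>\<phi>\<in>?A. real (card {\<psi> \<in> ?A. \<phi> ` e = \<psi> ` e}))"
  have m: "0 < card ?E" "real (card ?E) \<le> real n ^ 2"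
  proof -
    show "0 < card ?E" using L by simp
    have "card ?E \<le> card ([{..<n}]\<^bsup>2\<^esup>)"
      by (intro card_mono finite_imp_finite_nsets) (auto simp: non_edges_def)
    then show "real (card ?E) \<le> real n ^ 2" using binomial2_bounds(2)[OF n] by simp
  qed
  have Wc: "W = real (card {\<phi> \<in> ?A. \<phi> ` e \<in> ?E})"
    unfolding W_def w_def
    using sum_card_fibers[of ?A ?E "\<lambda>\<phi>. \<phi> ` e"] by (simp flip: of_nat_sum)
  have split: "?A = {\<phi> \<in> ?A. \<phi> ` e \<in> ?E} \<union> {\<phi> \<in> ?A. \<phi> ` e \<in> fst ` set H}"
  proof -
    have "\<phi> ` e \<in> ?E \<union> fst ` set H" if "\<phi> \<in> ?A" for \<phi>
    proof -
      have "\<phi> \<in> injections a n" using that embeddings_injections[of a n h H] by blast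
      from injection_nsets[OF this e] show ?thesis by (simp add: non_edges_def board_def)
    qed
    then show ?thesis by blast
  qed
  have "card ?A \<le> card {\<phi> \<in> ?A. \<phi> ` e \<in> ?E} + card {\<phi> \<in> ?A. \<phi> ` e \<in> fst ` set H}"
    by (rule ord_eq_le_trans[OF arg_cong[OF split, of card] card_Un_le])
  with Wc have W: "\<Gamma> / 2 \<le> W" using \<Gamma> closed by linarith
  \<comment> \<open>\<open>L / n^2\<close> underestimates the fraction drawn in this round but does
    not depend on the current board.\<close>
  have ratio: "real L / real n ^ 2 \<le> real L / real (card ?E)" "0 < real L / real n ^ 2"
    using m L n by (auto intro!: divide_left_mono)
  have "measure_pmf.prob (kernel_iter (free_step n \<sigma>) L H)
      {H'. \<forall>c<r. real (card (embeddings a n (h @ [(e, c)]) H')) < real L / real n ^ 2 * \<Gamma> / (4 * real r)}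
    \<le> measure_pmf.prob (kernel_iter (free_step n \<sigma>) L H)
      {H'. (\<Sum>f\<in>?E \<inter> fst ` set H'. w f) < real L / real (card ?E) * W / 2}"
  proof (rule prob_mono_on_support)
    fix H' assume H': "H' \<in> set_pmf (kernel_iter (free_step n \<sigma>) L H)"
      and *: "H' \<in> {H'. \<forall>c<r. real (card (embeddings a n (h @ [(e, c)]) H')) < real L / real n ^ 2 * \<Gamma> / (4 * real r)}"
    from free_invariants[OF \<sigma> L(2) H'] obtain s where s: "H' = H @ s" "snd ` set s \<subseteq> {..<r}" by blast
    have "(\<Sum>f\<in>?E \<inter> fst ` set H'. w f) \<le> (\<Sum>c<r. real (card (embeddings a n (h @ [(e, c)]) H')))"
      unfolding s(1) w_def by (rule extended_embeddings_ge[OF s(2)])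
    also have "\<dots> < (\<Sum>c<r. real L / real n ^ 2 * \<Gamma> / (4 * real r))"
      using * r by (intro sum_strict_mono) auto
    also have "\<dots> = real L / real n ^ 2 * (\<Gamma> / 2) / 2"
      using r by simp
    also have "\<dots> \<le> real L / real (card ?E) * W / 2"
      using ratio W \<Gamma> by (intro divide_right_mono mult_mono) auto
    finally show "H' \<in> {H'. (\<Sum>f\<in>?E \<inter> fst ` set H'. w f) < real L / real (card ?E) * W / 2}" by simp
  qed
  also have "\<dots> \<le> 4 * (\<Sum>f\<in>?E. (w f)\<^sup>2) / (real L / real (card ?E) * W\<^sup>2)"
    using W \<Gamma> by (intro weighted_draw_lower_tail[OF L _ W_def]) (auto simp: w_def)
  also have "\<dots> \<le> 4 * Z / (real L / real n ^ 2 * (\<Gamma> / 2)\<^sup>2)"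
  proof (rule frac_le)
    show "4 * (\<Sum>f\<in>?E. (w f)\<^sup>2) \<le> 4 * Z"
      unfolding w_def Z_def using sum_card_fibers_square_le[of ?A ?E "\<lambda>\<phi>. \<phi> ` e"] by simp
    show "0 \<le> 4 * Z" by (simp add: Z_def sum_nonneg)
    show "0 < real L / real n ^ 2 * (\<Gamma> / 2)\<^sup>2"
      using ratio \<Gamma> by (intro mult_pos_pos) auto
    show "real L / real n ^ 2 * (\<Gamma> / 2)\<^sup>2 \<le> real L / real (card ?E) * W\<^sup>2"
      using ratio W \<Gamma> by (intro mult_mono power_mono) auto
  qed
  also have "\<dots> = 16 / (real L / real n ^ 2 * \<Gamma>\<^sup>2) * Z"
    by (simp add: power_divide)
  finally show ?thesis by (simp add: Z_def)
qed

text \<open>Forgetting the colors leaves a sum of edge events whose probabilities can be bounded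
  uniformly over all Painter strategies.\<close>

lemma closed_copies_le_indicators:
  "real (card {\<phi> \<in> embeddings a n h H. \<phi> ` e \<in> fst ` set H})
    \<le> (\<Sum>\<phi>\<in>injections a n. indicator {H. (`) \<phi> ` insert e (fst ` set h) \<subseteq> fst ` set H} H)"
proof -
  let ?A = "{\<phi> \<in> embeddings a n h H. \<phi> ` e \<in> fst ` set H}"
  let ?I = "\<lambda>\<phi>. indicator {H. (`) \<phi> ` insert e (fst ` set h) \<subseteq> fst ` set H} H :: real"
  have "real (card ?A) = (\<Sum>\<phi>\<in>?A. ?I \<phi>)"
  proof -
    have "?I \<phi> = 1" if "\<phi> \<in> ?A" for \<phi>
      using that embeddings_edges[of \<phi> a n h H] by (simp add: indicator_def)
    then show ?thesis by simp
  qed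
  also have "\<dots> \<le> (\<Sum>\<phi>\<in>injections a n. ?I \<phi>)"
    by (intro sum_mono2) (auto simp: embeddings_def)
  finally show ?thesis .
qed

lemma overlapping_pairs_le_indicators:
  "(\<Sum>\<phi>\<in>embeddings a n h H. real (card {\<psi> \<in> embeddings a n h H. \<phi> ` e = \<psi> ` e}))
    \<le> (\<Sum>\<phi>\<in>injections a n. \<Sum>\<psi>\<in>{\<psi> \<in> injections a n. \<phi> ` e = \<psi> ` e}.
         indicator {H. (`) \<phi> ` (fst ` set h) \<union> (`) \<psi> ` (fst ` set h) \<subseteq> fst ` set H} H)"
proof -
  let ?A = "embeddings a n h H"
  let ?I = "\<lambda>\<phi> \<psi>. indicator {H. (`) \<phi> ` (fst ` set h) \<union> (`) \<psi> ` (fst ` set h) \<subseteq> fst ` set H} H :: real"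
  have sub: "(`) \<phi> ` (fst ` set h) \<subseteq> fst ` set H" if "\<phi> \<in> ?A" for \<phi>
    using that by (rule embeddings_edges)
  have "(\<Sum>\<phi>\<in>?A. real (card {\<psi> \<in> ?A. \<phi> ` e = \<psi> ` e})) = (\<Sum>\<phi>\<in>?A. \<Sum>\<psi>\<in>{\<psi> \<in> ?A. \<phi> ` e = \<psi> ` e}. ?I \<phi> \<psi>)"
  proof (rule sum.cong)
    fix \<phi> assume "\<phi> \<in> ?A"
    then have "?I \<phi> \<psi> = 1" if "\<psi> \<in> {\<psi> \<in> ?A. \<phi> ` e = \<psi> ` e}" for \<psi>
      using that sub[of \<phi>] sub[of \<psi>] by (auto simp: indicator_def)
    then show "real (card {\<psi> \<in> ?A. \<phi> ` e = \<psi> ` e}) = (\<Sum>\<psi>\<in>{\<psi> \<in> ?A. \<phi> ` e = \<psi> ` e}. ?I \<phi> \<psi>)"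
      by simp
  qed simp
  also have "\<dots> \<le> (\<Sum>\<phi>\<in>?A. \<Sum>\<psi>\<in>{\<psi> \<in> injections a n. \<phi> ` e = \<psi> ` e}. ?I \<phi> \<psi>)"
    using embeddings_injections[of a n h H]
    by (intro sum_mono sum_mono2 finite_subset[OF _ finite_injections[of a n]]) auto
  also have "\<dots> \<le> (\<Sum>\<phi>\<in>injections a n. \<Sum>\<psi>\<in>{\<psi> \<in> injections a n. \<phi> ` e = \<psi> ` e}. ?I \<phi> \<psi>)"
    by (intro sum_mono2 finite_injections embeddings_injections sum_nonneg) auto
  finally show ?thesis .
qed

section \<open>Induction over the rounds\<close>

text \<open>Only the length of the position is fixed: which position becomes frequent depends on
  Painter's answers.\<close>

definition rich ::
  "(history \<Rightarrow> edge) \<Rightarrow> nat \<Rightarrow> nat \<Rightarrow> real \<Rightarrow> nat \<Rightarrow> nat \<Rightarrow> real \<Rightarrow> history \<Rightarrow> bool" where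
  "rich \<beta> r a d n k x H \<longleftrightarrow>
     (\<exists>h. legal_play \<beta> r a d h \<and> length h = k \<and> x \<le> real (card (embeddings a n h H)))"

lemma prob_bind_le:
  assumes "\<And>x. x \<in> set_pmf M \<Longrightarrow> measure_pmf.prob (f x) A \<le> g x" "integrable (measure_pmf M) g"
  shows "measure_pmf.prob (bind_pmf M f) A \<le> integral\<^sup>L (measure_pmf M) g"
  unfolding measure_bind_pmf
proof (rule integral_mono_AE)
  show "integrable (measure_pmf M) (\<lambda>x. measure_pmf.prob (f x) A)"
    by (rule measure_pmf.integrable_const_bound[where B = 1]) auto
qed (use assms in \<open>auto simp: AE_measure_pmf_iff\<close>)

text \<open>Condition on the board \<open>H\<close> after \<open>k\<close> rounds. If
  \<open>H\<close> is lost, it stays lost. If it is not rich, the first term pays. Otherwise some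
  position \<open>h\<close> has \<open>\<Gamma>\<close> copies: either half of
  \<open>\<Gamma>\<close> are closed, which the first-moment term pays for by Markov's inequality,
  or \<open>failing_round_le\<close> supplies the second-moment term.\<close>

lemma not_rich_Suc_le:
  fixes \<sigma> :: online_strategy and F :: "'a ugraph" and \<Gamma> :: real
  assumes \<sigma>: "online_painter r \<sigma>" and r: "0 < r"
    and adv: "\<And>h. legal_play \<beta> r a d h \<Longrightarrow> \<not> mono_copy F a h \<Longrightarrow> legal_move a d h (\<beta> h)"
    and L: "0 < L" "k * L + L \<le> n choose 2" and n: "2 \<le> n" and \<Gamma>: "0 < \<Gamma>"
  defines "S \<equiv> {h. legal_play \<beta> r a d h \<and> length h = k \<and> legal_move a d h (\<beta> h)}"
    and "P \<equiv> kernel_iter (free_step n \<sigma>) (k * L) []"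
  shows "measure_pmf.prob (kernel_iter (free_step n \<sigma>) (Suc k * L) [])
      {H. \<not> mono_copy F n H \<and> \<not> rich \<beta> r a d n (Suc k) (real L / real n ^ 2 * \<Gamma> / (4 * real r)) H}
    \<le> measure_pmf.prob P {H. \<not> mono_copy F n H \<and> \<not> rich \<beta> r a d n k \<Gamma> H}
      + (\<Sum>h\<in>S. 2 / \<Gamma> * (\<Sum>\<phi>\<in>injections a n.
            measure_pmf.prob P {H. (`) \<phi> ` insert (\<beta> h) (fst ` set h) \<subseteq> fst ` set H})
          + 16 / (real L / real n ^ 2 * \<Gamma>\<^sup>2) *
            (\<Sum>\<phi>\<in>injections a n. \<Sum>\<psi>\<in>{\<psi> \<in> injections a n. \<phi> ` \<beta> h = \<psi> ` \<beta> h}.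
              measure_pmf.prob P {H. (`) \<phi> ` (fst ` set h) \<union> (`) \<psi> ` (fst ` set h) \<subseteq> fst ` set H}))"
proof -
  define B where "B = {H. \<not> mono_copy F n H \<and> \<not> rich \<beta> r a d n (Suc k) (real L / real n ^ 2 * \<Gamma> / (4 * real r)) H}"
  define A where "A = {H. \<not> mono_copy F n H \<and> \<not> rich \<beta> r a d n k \<Gamma> H}"
  define y where "y = 2 / \<Gamma>"
  define z where "z = 16 / (real L / real n ^ 2 * \<Gamma>\<^sup>2)"
  define Y where "Y h H = (\<Sum>\<phi>\<in>injections a n.
      indicator {H. (`) \<phi> ` insert (\<beta> h) (fst ` set h) \<subseteq> fst ` set H} H :: real)" for h H :: history
  define Z where "Z h H = (\<Sum>\<phi>\<in>injections a n. \<Sum>\<psi>\<in>{\<psi> \<in> injections a n. \<phi> ` \<beta> h = \<psi> ` \<beta> h}.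
      indicator {H. (`) \<phi> ` (fst ` set h) \<union> (`) \<psi> ` (fst ` set h) \<subseteq> fst ` set H} H :: real)" for h H :: history
  \<comment> \<open>A pointwise majorant of the conditional failure probability. The position
    \<open>h\<close> depends on \<open>H\<close>, so the error terms of all candidates in
    \<open>S\<close> are added.\<close>
  define g where "g H = indicator A H + (\<Sum>h\<in>S. y * Y h H + z * Z h H)" for H
  have yz: "y \<ge> 0" "z \<ge> 0" using \<Gamma> by (auto simp: y_def z_def)
  have YZ: "Y h H \<ge> 0" "Z h H \<ge> 0" for h H
    by (auto simp: Y_def Z_def intro!: sum_nonneg)
  have fS: "finite S"
    by (rule finite_subset[OF _ finite_legal_play[of \<beta> r a d k]]) (auto simp: S_def)
  have nn: "0 \<le> y * Y h H + z * Z h H" for h H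
    using yz YZ by simp
  have E0: "non_edges n [] = [{..<n}]\<^bsup>2\<^esup>" by (simp add: non_edges_def board_def)
  have pointwise: "measure_pmf.prob (kernel_iter (free_step n \<sigma>) L H) B \<le> g H" if H: "H \<in> set_pmf P" for H
  proof -
    have le1: "measure_pmf.prob (kernel_iter (free_step n \<sigma>) L H) B \<le> 1" by simp
    have Snn: "0 \<le> (\<Sum>h\<in>S. y * Y h H + z * Z h H)" by (intro sum_nonneg nn)
    have Lc: "L \<le> card (non_edges n H)"
      using free_invariants[OF \<sigma> _ H[unfolded P_def]] L(2) by (auto simp: E0)
    consider "mono_copy F n H" | "H \<in> A"
      | h where "\<not> mono_copy F n H" "legal_play \<beta> r a d h" "length h = k" "\<Gamma> \<le> real (card (embeddings a n h H))"
      by (auto simp: A_def rich_def)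
    then show ?thesis
    proof cases
      case 1
      have "measure_pmf.prob (kernel_iter (free_step n \<sigma>) L H) B \<le> measure_pmf.prob (kernel_iter (free_step n \<sigma>) L H) {}"
        using free_extends[of _ n \<sigma> L H] mono_copy_mono[OF 1]
        by (intro prob_mono_on_support) (auto simp: B_def)
      moreover have "0 \<le> (indicator A H :: real)" by simp
      ultimately show ?thesis using Snn unfolding g_def measure_empty by linarith
    next
      case 2
      then have "g H = 1 + (\<Sum>h\<in>S. y * Y h H + z * Z h H)" by (simp add: g_def)
      then show ?thesis using le1 Snn by linarith
    next
      case 3
      have "embeddings a n h H \<noteq> {}" using 3(4) \<Gamma> by auto
      then have "\<not> mono_copy F a h" using mono_copy_embedding[of F a h _ n H] 3(1) by blast
      then have e: "legal_move a d h (\<beta> h)" using adv 3(2) by blast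
      then have e2: "\<beta> h \<in> [{..<a}]\<^bsup>2\<^esup>" by (simp add: legal_move_def non_edges_def)
      have "measure_pmf.prob (kernel_iter (free_step n \<sigma>) L H) B \<le> y * Y h H + z * Z h H"
      proof (cases "real (card {\<phi> \<in> embeddings a n h H. \<phi> ` \<beta> h \<in> fst ` set H}) < \<Gamma> / 2")
        case True
        have "measure_pmf.prob (kernel_iter (free_step n \<sigma>) L H) B
          \<le> measure_pmf.prob (kernel_iter (free_step n \<sigma>) L H)
            {H'. \<forall>c<r. real (card (embeddings a n (h @ [(\<beta> h, c)]) H')) < real L / real n ^ 2 * \<Gamma> / (4 * real r)}"
        proof (rule prob_mono_on_support)
          fix H' assume "H' \<in> B"
          then have nr: "\<not> rich \<beta> r a d n (Suc k) (real L / real n ^ 2 * \<Gamma> / (4 * real r)) H'"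
            by (simp add: B_def)
          have "real (card (embeddings a n (h @ [(\<beta> h, c)]) H')) < real L / real n ^ 2 * \<Gamma> / (4 * real r)" if "c < r" for c
          proof (rule ccontr)
            assume "\<not> ?thesis"
            moreover have "legal_play \<beta> r a d (h @ [(\<beta> h, c)])"
              using 3(2) e that by (rule legal_play.snoc)
            moreover have "length (h @ [(\<beta> h, c)]) = Suc k" using 3(3) by simp
            ultimately show False using nr unfolding rich_def by (meson not_less)
          qed
          then show "H' \<in> {H'. \<forall>c<r. real (card (embeddings a n (h @ [(\<beta> h, c)]) H')) < real L / real n ^ 2 * \<Gamma> / (4 * real r)}"
            by blast
        qed
        also have "\<dots> \<le> z * (\<Sum>\<phi>\<in>embeddings a n h H. real (card {\<psi> \<in> embeddings a n h H. \<phi> ` \<beta> h = \<psi> ` \<beta> h}))"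
          unfolding z_def by (rule failing_round_le[OF \<sigma> r L(1) Lc n e2 \<Gamma> 3(4) True])
        also have "\<dots> \<le> z * Z h H"
          unfolding Z_def by (intro mult_left_mono overlapping_pairs_le_indicators yz)
        also have "\<dots> \<le> y * Y h H + z * Z h H" using yz YZ by simp
        finally show ?thesis .
      next
        \<comment> \<open>With \<open>y = 2 / \<Gamma>\<close> the term \<open>y * Y h H\<close> is
          already at least 1, so the trivial bound on a probability suffices.\<close>
        case False
        then have "\<Gamma> / 2 \<le> Y h H"
          using closed_copies_le_indicators[of a n h H "\<beta> h"] unfolding Y_def by linarith
        then have "y * (\<Gamma> / 2) \<le> y * Y h H" by (intro mult_left_mono yz)
        then have "1 \<le> y * Y h H" using \<Gamma> by (simp add: y_def)
        moreover have "0 \<le> z * Z h H" using yz YZ by simp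
        ultimately show ?thesis using le1 by linarith
      qed
      also have "\<dots> \<le> (\<Sum>h\<in>S. y * Y h H + z * Z h H)"
        using 3 e fS nn by (intro member_le_sum) (auto simp: S_def)
      also have "\<dots> \<le> g H" by (simp add: g_def)
      finally show ?thesis .
    qed
  qed
  have ind: "integrable (measure_pmf P) (indicator D :: history \<Rightarrow> real)" for D
    by (rule measure_pmf.integrable_const_bound[where B = 1]) (auto simp: indicator_def)
  have intY: "integrable (measure_pmf P) (Y h)" for h
    unfolding Y_def by (intro Bochner_Integration.integrable_sum ind)
  have intZ: "integrable (measure_pmf P) (Z h)" for h
    unfolding Z_def by (intro Bochner_Integration.integrable_sum ind)
  have EY: "integral\<^sup>L (measure_pmf P) (Y h) = (\<Sum>\<phi>\<in>injections a n.
      measure_pmf.prob P {H. (`) \<phi> ` insert (\<beta> h) (fst ` set h) \<subseteq> fst ` set H})" for h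
    unfolding Y_def by (subst Bochner_Integration.integral_sum) (auto simp: ind)
  have EZ: "integral\<^sup>L (measure_pmf P) (Z h) =
      (\<Sum>\<phi>\<in>injections a n. \<Sum>\<psi>\<in>{\<psi> \<in> injections a n. \<phi> ` \<beta> h = \<psi> ` \<beta> h}.
        measure_pmf.prob P {H. (`) \<phi> ` (fst ` set h) \<union> (`) \<psi> ` (fst ` set h) \<subseteq> fst ` set H})" for h
    unfolding Z_def
    by (subst Bochner_Integration.integral_sum, intro Bochner_Integration.integrable_sum ind,
        intro sum.cong refl, subst Bochner_Integration.integral_sum, rule ind, simp)
  have intS: "integrable (measure_pmf P) (\<lambda>H. \<Sum>h\<in>S. y * Y h H + z * Z h H)"
    by (intro Bochner_Integration.integrable_sum Bochner_Integration.integrable_add integrable_mult_right intY intZ)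
  have "measure_pmf.prob (kernel_iter (free_step n \<sigma>) (Suc k * L) []) B
      = measure_pmf.prob (bind_pmf P (kernel_iter (free_step n \<sigma>) L)) B"
    unfolding P_def kernel_iter_add[symmetric] by (simp add: add.commute)
  also have "\<dots> \<le> integral\<^sup>L (measure_pmf P) g"
  proof (rule prob_bind_le[OF pointwise])
    show "integrable (measure_pmf P) g"
      unfolding g_def by (intro Bochner_Integration.integrable_add ind intS)
  qed
  also have "\<dots> = measure_pmf.prob P A + integral\<^sup>L (measure_pmf P) (\<lambda>H. \<Sum>h\<in>S. y * Y h H + z * Z h H)"
    unfolding g_def by (subst Bochner_Integration.integral_add[OF ind intS]) simp
  also have "integral\<^sup>L (measure_pmf P) (\<lambda>H. \<Sum>h\<in>S. y * Y h H + z * Z h H)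
      = (\<Sum>h\<in>S. y * integral\<^sup>L (measure_pmf P) (Y h) + z * integral\<^sup>L (measure_pmf P) (Z h))"
    by (simp add: intY intZ)
  finally show ?thesis
    unfolding A_def[symmetric] B_def[symmetric] y_def[symmetric] z_def[symmetric] EY EZ .
qed

text \<open>The constants \<open>c\<close> and \<open>D\<close> may depend on \<open>k\<close> but
  not on \<open>n\<close>, \<open>L\<close>, \<open>p\<close> or the strategy. The factor 4 in
  \<open>p\<close> compensates for \<open>n choose 2\<close> being as small as
  \<open>n^2 / 4\<close>, so \<open>p\<close> bounds the edge density throughout all
  \<open>R\<close> rounds.\<close>

lemma not_rich_le:
  fixes F :: "'a ugraph"
  assumes r: "0 < r" and R: "0 < R"
    and adv: "\<And>h. legal_play \<beta> r a d h \<Longrightarrow> \<not> mono_copy F a h \<Longrightarrow> legal_move a d h (\<beta> h)"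
  shows "k \<le> R \<Longrightarrow> \<exists>c>0. \<exists>D\<ge>0. \<forall>n L \<sigma> p. online_painter r \<sigma> \<longrightarrow> 0 < L \<longrightarrow> a \<le> n \<longrightarrow> 2 \<le> n \<longrightarrow>
      p = 4 * real R * real L / real n ^ 2 \<longrightarrow> p \<le> 1 \<longrightarrow> real a * p powr (- d) \<le> real n \<longrightarrow>
      measure_pmf.prob (kernel_iter (free_step n \<sigma>) (k * L) [])
        {H. \<not> mono_copy F n H \<and> \<not> rich \<beta> r a d n k (c * real n ^ a * p ^ k) H}
      \<le> D * (p + p powr (- d) / real n)"
proof (induction k)
  case 0
  show ?case
  proof (rule exI[of _ "(1 / (2 * real a)) ^ a"], intro conjI exI[of _ 0] allI impI)
    show "0 < (1 / (2 * real a)) ^ a" by (cases "a = 0") auto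
    fix n L :: nat and \<sigma> :: online_strategy and p :: real
    assume "a \<le> n"
    then have "rich \<beta> r a d n 0 ((1 / (2 * real a)) ^ a * real n ^ a * p ^ 0) H" for H
      using card_embeddings_Nil[of a n H] legal_play.Nil[of \<beta> r a d] unfolding rich_def by auto
    then show "measure_pmf.prob (kernel_iter (free_step n \<sigma>) (0 * L) [])
        {H. \<not> mono_copy F n H \<and> \<not> rich \<beta> r a d n 0 ((1 / (2 * real a)) ^ a * real n ^ a * p ^ 0) H}
      \<le> 0 * (p + p powr (- d) / real n)" by simp
  qed simp
next
  case (Suc k)
  then obtain c D where c: "c > 0" and D: "D \<ge> 0" and
    IH: "\<And>n L \<sigma> p. online_painter r \<sigma> \<Longrightarrow> 0 < L \<Longrightarrow> a \<le> n \<Longrightarrow> 2 \<le> n \<Longrightarrow>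
      p = 4 * real R * real L / real n ^ 2 \<Longrightarrow> p \<le> 1 \<Longrightarrow> real a * p powr (- d) \<le> real n \<Longrightarrow>
      measure_pmf.prob (kernel_iter (free_step n \<sigma>) (k * L) [])
        {H. \<not> mono_copy F n H \<and> \<not> rich \<beta> r a d n k (c * real n ^ a * p ^ k) H}
      \<le> D * (p + p powr (- d) / real n)" by (auto simp: Suc_le_eq)
  define S where "S = {h. legal_play \<beta> r a d h \<and> length h = k \<and> legal_move a d h (\<beta> h)}"
  \<comment> \<open>\<open>C1\<close> and \<open>C2\<close> are what remains of the two error terms
    of \<open>not_rich_Suc_le\<close> once the powers of \<open>n\<close> and \<open>p\<close>
    cancel against \<open>\<Gamma>\<close>.\<close>
  define C1 where "C1 = 2 / c"
  define C2 where "C2 = 64 * real R * real a * 2 ^ a / c\<^sup>2"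
  have C: "C1 \<ge> 0" "C2 \<ge> 0" using c by (auto simp: C1_def C2_def)
  show ?case
  proof (rule exI[of _ "c / (16 * real R * real r)"], intro conjI exI[of _ "D + real (card S) * (C1 + C2)"] allI impI)
    show "0 < c / (16 * real R * real r)" using c r R by simp
    show "0 \<le> D + real (card S) * (C1 + C2)" using D C by simp
    fix n L :: nat and \<sigma> :: online_strategy and p :: real
    assume \<sigma>: "online_painter r \<sigma>" and L: "0 < L" and an: "a \<le> n" and n: "2 \<le> n"
      and p: "p = 4 * real R * real L / real n ^ 2" and p1: "p \<le> 1" and q: "real a * p powr (- d) \<le> real n"
    define \<epsilon> where "\<epsilon> = p powr (- d) / real n"
    define \<Gamma> where "\<Gamma> = c * real n ^ a * p ^ k"
    have p0: "p > 0" using p L R n by simp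
    have \<epsilon>: "\<epsilon> \<ge> 0" by (simp add: \<epsilon>_def)
    have \<Gamma>: "\<Gamma> > 0" using c p0 n by (simp add: \<Gamma>_def)
    have Lp: "real L / real n ^ 2 = p / (4 * real R)" using p R by simp
    have RL: "real (R * L) = p * (real n ^ 2 / 4)" using p n by simp
    have RL2: "real (R * L) \<le> p * real (n choose 2)"
      unfolding RL using binomial2_bounds(1)[OF n] p0 by (intro mult_left_mono) auto
    also have "\<dots> \<le> real (n choose 2)" using p1 by (simp add: mult_left_le_one_le p0 less_imp_le)
    finally have RL3: "R * L \<le> n choose 2" by (simp only: of_nat_le_iff)
    have kR: "k * L + L \<le> R * L" "k * L \<le> R * L"
      using mult_le_mono1[OF Suc.prems, of L] Suc.prems by auto
    have t: "k * L \<le> n choose 2" "k * L + L \<le> n choose 2" "real (k * L) \<le> p * real (n choose 2)"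
      using kR RL3 RL2 by linarith+
    \<comment> \<open>Each round multiplies the constant by \<open>1 / (16 * R * r)\<close>:
      \<open>1 / (4 * R)\<close> from \<open>L / n^2 = p / (4 * R)\<close>, and
      \<open>1 / (4 * r)\<close> from the round itself.\<close>
    have \<Gamma>': "real L / real n ^ 2 * \<Gamma> / (4 * real r) = c / (16 * real R * real r) * real n ^ a * p ^ Suc k"
      unfolding Lp \<Gamma>_def by (simp add: field_simps)
    let ?P = "kernel_iter (free_step n \<sigma>) (k * L) []"
    have term_le: "2 / \<Gamma> * (\<Sum>\<phi>\<in>injections a n.
            measure_pmf.prob ?P {H. (`) \<phi> ` insert (\<beta> h) (fst ` set h) \<subseteq> fst ` set H})
          + 16 / (real L / real n ^ 2 * \<Gamma>\<^sup>2) *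
            (\<Sum>\<phi>\<in>injections a n. \<Sum>\<psi>\<in>{\<psi> \<in> injections a n. \<phi> ` \<beta> h = \<psi> ` \<beta> h}.
              measure_pmf.prob ?P {H. (`) \<phi> ` (fst ` set h) \<union> (`) \<psi> ` (fst ` set h) \<subseteq> fst ` set H})
        \<le> C1 * p + C2 * \<epsilon>" if h: "h \<in> S" for h
    proof (rule add_mono)
      have h': "legal_play \<beta> r a d h" "length h = k" "legal_move a d h (\<beta> h)"
        using h by (auto simp: S_def)
      have D2: "insert (\<beta> h) (fst ` set h) \<subseteq> [{..<a}]\<^bsup>2\<^esup>" "card (insert (\<beta> h) (fst ` set h)) = Suc k"
        using legal_play_edges[OF h'(1)] card_legal_play_edges[OF h'(1)] h'(2,3)
        by (auto simp: legal_move_def non_edges_def board_def)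
      have "2 / \<Gamma> * (\<Sum>\<phi>\<in>injections a n.
            measure_pmf.prob ?P {H. (`) \<phi> ` insert (\<beta> h) (fst ` set h) \<subseteq> fst ` set H})
          \<le> 2 / \<Gamma> * (real n ^ a * p ^ Suc k)"
        using expected_closed_copies[OF t(1,3) less_imp_le[OF p0] D2(1), of \<sigma>] \<Gamma> D2(2)
        by (intro mult_left_mono) auto
      also have "\<dots> = C1 * p"
        using c p0 n by (simp add: \<Gamma>_def C1_def)
      finally show "2 / \<Gamma> * (\<Sum>\<phi>\<in>injections a n.
            measure_pmf.prob ?P {H. (`) \<phi> ` insert (\<beta> h) (fst ` set h) \<subseteq> fst ` set H}) \<le> C1 * p" .
      have "16 / (real L / real n ^ 2 * \<Gamma>\<^sup>2) *
            (\<Sum>\<phi>\<in>injections a n. \<Sum>\<psi>\<in>{\<psi> \<in> injections a n. \<phi> ` \<beta> h = \<psi> ` \<beta> h}.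
              measure_pmf.prob ?P {H. (`) \<phi> ` (fst ` set h) \<union> (`) \<psi> ` (fst ` set h) \<subseteq> fst ` set H})
          \<le> 16 / (real L / real n ^ 2 * \<Gamma>\<^sup>2) *
            (real a * 2 ^ a * p ^ (2 * k + 1) * real n ^ (2 * a) * \<epsilon>)"
        using expected_overlapping_pairs[OF h'(1,3) p0 p1 _ q t(1,3), of \<sigma>] h'(2) n
        by (intro mult_left_mono) (auto simp: \<epsilon>_def)
      also have "\<dots> = C2 * \<epsilon>"
      proof -
        have "real n ^ (2 * a) = (real n ^ a)\<^sup>2" "p ^ (2 * k + 1) = p * (p ^ k)\<^sup>2"
          by (simp_all add: power_mult[symmetric] mult.commute)
        then show ?thesis
          unfolding Lp \<Gamma>_def C2_def using c p0 n R by (simp add: field_simps power_mult_distrib)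
      qed
      finally show "16 / (real L / real n ^ 2 * \<Gamma>\<^sup>2) *
            (\<Sum>\<phi>\<in>injections a n. \<Sum>\<psi>\<in>{\<psi> \<in> injections a n. \<phi> ` \<beta> h = \<psi> ` \<beta> h}.
              measure_pmf.prob ?P {H. (`) \<phi> ` (fst ` set h) \<union> (`) \<psi> ` (fst ` set h) \<subseteq> fst ` set H})
          \<le> C2 * \<epsilon>" .
    qed
    have "measure_pmf.prob (kernel_iter (free_step n \<sigma>) (Suc k * L) [])
        {H. \<not> mono_copy F n H \<and> \<not> rich \<beta> r a d n (Suc k) (real L / real n ^ 2 * \<Gamma> / (4 * real r)) H}
      \<le> measure_pmf.prob ?P {H. \<not> mono_copy F n H \<and> \<not> rich \<beta> r a d n k \<Gamma> H} + (\<Sum>h\<in>S. C1 * p + C2 * \<epsilon>)"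
      using not_rich_Suc_le[OF \<sigma> r adv L t(2) n \<Gamma>] sum_mono[OF term_le]
      unfolding S_def[symmetric] by (rule order_trans[OF _ add_left_mono])
    also have "\<dots> \<le> D * (p + \<epsilon>) + real (card S) * (C1 * p + C2 * \<epsilon>)"
      using IH[OF \<sigma> L an n p p1 q] by (simp add: \<Gamma>_def \<epsilon>_def)
    also have "\<dots> \<le> D * (p + \<epsilon>) + real (card S) * ((C1 + C2) * (p + \<epsilon>))"
    proof -
      have "0 \<le> C1 * \<epsilon> + C2 * p" using C \<epsilon> p0 by simp
      then have "C1 * p + C2 * \<epsilon> \<le> (C1 + C2) * (p + \<epsilon>)" by (simp add: algebra_simps)
      then show ?thesis by (intro add_left_mono mult_left_mono) auto
    qed
    also have "\<dots> = (D + real (card S) * (C1 + C2)) * (p + \<epsilon>)" by (simp add: algebra_simps)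
    finally show "measure_pmf.prob (kernel_iter (free_step n \<sigma>) (Suc k * L) [])
        {H. \<not> mono_copy F n H \<and> \<not> rich \<beta> r a d n (Suc k) (c / (16 * real R * real r) * real n ^ a * p ^ Suc k) H}
      \<le> (D + real (card S) * (C1 + C2)) * (p + p powr (- d) / real n)"
      unfolding \<Gamma>' \<epsilon>_def .
  qed
qed

section \<open>The threshold\<close>

text \<open>After one round more than there are edges on \<open>a\<close> vertices, no legal play of
  that length exists, so no board is rich and the failure event is exactly the absence of a
  copy.\<close>

lemma no_mono_copy_le:
  fixes F :: "'a ugraph"
  assumes "0 < r" and win: "builder_wins_on F r d a"
  shows "\<exists>D\<ge>0. \<forall>n L \<sigma> p. online_painter r \<sigma> \<longrightarrow> 0 < L \<longrightarrow> a \<le> n \<longrightarrow> 2 \<le> n \<longrightarrow>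
      p = 4 * real (Suc (a choose 2)) * real L / real n ^ 2 \<longrightarrow> p \<le> 1 \<longrightarrow> real a * p powr (- d) \<le> real n \<longrightarrow>
      measure_pmf.prob (kernel_iter (free_step n \<sigma>) (Suc (a choose 2) * L) []) {H. \<not> mono_copy F n H}
      \<le> D * (p + p powr (- d) / real n)"
proof -
  from win obtain \<beta> where \<beta>: "\<And>\<pi>. (\<forall>h e. \<pi> h e < r) \<Longrightarrow>
          (\<exists>k. (\<forall>j<k. legal_move a d (det_play \<beta> \<pi> j) (\<beta> (det_play \<beta> \<pi> j))) \<and>
               mono_copy F a (det_play \<beta> \<pi> k))"
    unfolding builder_wins_on_def by blast
  have adv: "legal_move a d h (\<beta> h)" if "legal_play \<beta> r a d h" "\<not> mono_copy F a h" for h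
    using winning_strategy_legal[OF \<beta> \<open>0 < r\<close> that] by blast
  have "\<not> rich \<beta> r a d n (Suc (a choose 2)) x H" for n x H
    using length_legal_play[of \<beta> r a d] unfolding rich_def by force
  moreover have "0 < Suc (a choose 2)" by simp
  note not_rich_le[where F = F, OF \<open>0 < r\<close> this adv order_refl]
  ultimately show ?thesis by simp
qed

text \<open>Builder must present at least one edge, and a single edge has density 1/2. This makes
  the exponent \<open>2 - 1 / d\<close> nonnegative, so that the threshold function is at least 1
  and absorbs rounding errors.\<close>

lemma builder_wins_density_ge_half:
  assumes "uedges F \<noteq> {}" "0 < r" and win: "builder_wins_on F r d a"
  shows "1 / 2 \<le> d"
proof -
  from win obtain \<beta> where \<beta>: "\<And>\<pi>. (\<forall>h e. \<pi> h e < r) \<Longrightarrow>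
          (\<exists>k. (\<forall>j<k. legal_move a d (det_play \<beta> \<pi> j) (\<beta> (det_play \<beta> \<pi> j))) \<and>
               mono_copy F a (det_play \<beta> \<pi> k))"
    unfolding builder_wins_on_def by blast
  have "\<not> mono_copy F a []" using assms(1) by (auto simp: mono_copy_def)
  from winning_strategy_legal[OF \<beta> assms(2) legal_play.Nil this]
  have e: "legal_move a d [] (\<beta> [])" by blast
  then have e2: "\<beta> [] \<in> [{..<a}]\<^bsup>2\<^esup>" by (simp add: legal_move_def non_edges_def)
  then have "\<beta> [] \<subseteq> {..<a}" "card (\<beta> []) = 2" "finite (\<beta> [])" by (auto simp: nsets_def)
  then have "real (card {\<beta> []}) \<le> d * real (card (\<beta> []))"
    by (intro density_bound[OF e]) (auto simp: nsets_def)
  then show ?thesis using \<open>card (\<beta> []) = 2\<close> by simp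
qed

theorem theorem4:
  fixes F :: "'a ugraph" and r :: nat and d :: real
  assumes "simple_graph F" and "uedges F \<noteq> {}"
    and "r \<ge> 2"
    and "d > 0"
    and "builder_has_winning_strategy F r d"
  shows "threshold_upper_bound F r (\<lambda>n. real n powr (2 - 1 / d))"
  unfolding threshold_upper_bound_def
proof (intro allI impI)
  fix N :: "nat \<Rightarrow> nat" and \<sigma> :: "nat \<Rightarrow> online_strategy"
  assume N: "(\<lambda>n. real (N n)) \<in> \<omega>(\<lambda>n. real n powr (2 - 1 / d))"
    and \<sigma>: "\<forall>n. online_painter r (\<sigma> n)"
  have r: "0 < r" using assms(3) by simp
  obtain a where a: "builder_wins_on F r d a"
    using assms(5) by (auto simp: builder_has_winning_strategy_def)
  have d: "1 / 2 \<le> d" using builder_wins_density_ge_half[OF assms(2) r a] .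
  define R where "R = Suc (a choose 2)"
  have R: "0 < R" by (simp add: R_def)
  obtain D where D: "D \<ge> 0" and bound: "\<And>n L p. 0 < L \<Longrightarrow> a \<le> n \<Longrightarrow> 2 \<le> n \<Longrightarrow>
      p = 4 * real R * real L / real n ^ 2 \<Longrightarrow> p \<le> 1 \<Longrightarrow> real a * p powr (- d) \<le> real n \<Longrightarrow>
      measure_pmf.prob (kernel_iter (free_step n (\<sigma> n)) (R * L) []) {H. \<not> mono_copy F n H}
      \<le> D * (p + p powr (- d) / real n)"
    using no_mono_copy_le[OF r a] \<sigma> unfolding R_def[symmetric] by blast
  define g where "g n = real n powr (2 - 1 / d)" for n :: nat
  \<comment> \<open>Capping \<open>N\<close> at \<open>x\<close> forces \<open>p \<rightarrow> 0\<close> and keeps the number of steps in \<open>\<omega>(g)\<close>.\<close>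
  define x where "x n = real n powr (2 - 1 / (2 * d))" for n :: nat
  define L where "L n = min (N n) (nat \<lfloor>x n\<rfloor>) div R" for n
  define p where "p n = 4 * real R * real (L n) / real n ^ 2" for n
  define u where "u n = real (L n) / g n" for n
  define \<epsilon> where "\<epsilon> n = p n powr (- d) / real n" for n
  have ev1: "eventually (\<lambda>n::nat. 1 \<le> n) sequentially" by (rule eventually_ge_at_top)
  have LN: "R * L n \<le> min (N n) (nat \<lfloor>x n\<rfloor>)" for n
    by (simp only: L_def) (rule times_div_less_eq_dividend)
  have x0: "0 \<le> x n" for n by (simp add: x_def)
  have Lx: "real R * real (L n) \<le> x n" for n
  proof -
    have "real (R * L n) \<le> real (nat \<lfloor>x n\<rfloor>)" using LN[of n] by (simp only: of_nat_le_iff)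
    then show ?thesis using x0[of n] by (simp add: le_floor_iff) linarith
  qed
  have grow: "filterlim (\<lambda>n::nat. real n powr (1 / (2 * d))) at_top sequentially"
    using assms(4) by real_asymp
  have u_top: "filterlim u at_top sequentially"
    unfolding filterlim_at_top_ge[where c = 0]
  proof (intro allI impI)
    fix C :: real assume C: "0 \<le> C"
    \<comment> \<open>The summands \<open>R\<close> and \<open>1\<close> pay for the division by
      \<open>R\<close> and for the floor; both losses are absorbed because
      \<open>g n \<ge> 1\<close>.\<close>
    define C' where "C' = real R * C + real R + 1"
    have "eventually (\<lambda>n. norm (real (N n)) \<ge> C' * norm (g n)) sequentially"
      using smallomegaD[OF N, of C'] by (simp add: g_def)
    \<comment> \<open>The cap \<open>x\<close> exceeds \<open>g\<close> by exactly this factor, so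
      it eventually lies above every multiple of \<open>g\<close>.\<close>
    moreover have "eventually (\<lambda>n::nat. real n powr (1 / (2 * d)) \<ge> C') sequentially"
      using grow by (simp add: filterlim_at_top)
    ultimately show "eventually (\<lambda>n. C \<le> u n) sequentially"
      using ev1
    proof eventually_elim
      case (elim n)
      have g1: "1 \<le> g n" unfolding g_def
        using elim(3) d by (intro ge_one_powr_ge_zero) (auto simp: field_simps)
      have "x n = real n powr (1 / (2 * d)) * g n"
        unfolding x_def g_def powr_add[symmetric] using assms(4) by (simp add: field_simps)
      then have "C' * g n \<le> x n" using elim(2) g1 by (simp add: mult_right_mono)
      then have "C' * g n - 1 \<le> real (nat \<lfloor>x n\<rfloor>)" using x0[of n] by linarith
      moreover have "C' * g n \<le> real (N n)" using elim(1) g1 by simp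
      ultimately have "C' * g n - 1 \<le> real (min (N n) (nat \<lfloor>x n\<rfloor>))" by (simp add: min_def)
      also have "min (N n) (nat \<lfloor>x n\<rfloor>) < R * L n + R"
        unfolding L_def using R by (simp add: dividend_less_times_div add.commute)
      then have "real (min (N n) (nat \<lfloor>x n\<rfloor>)) \<le> real R * real (L n) + real R"
        by (metis less_imp_le of_nat_add of_nat_le_iff of_nat_mult)
      finally have "C' * g n - (1 + real R) \<le> real R * real (L n)" by simp
      moreover have "1 + real R \<le> (1 + real R) * g n" using g1 by simp
      ultimately have "real R * (C * g n) \<le> real R * real (L n)"
        unfolding C'_def by (simp add: algebra_simps)
      then have "C * g n \<le> real (L n)" using R by simp
      then show ?case unfolding u_def using g1 by (simp add: le_divide_eq)
    qed
  qed
  have p_lim: "p \<longlonglongrightarrow> 0"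
  proof (rule tendsto_sandwich[where f = "\<lambda>_. 0" and h = "\<lambda>n. 4 * real n powr (- 1 / (2 * d))"])
    show "eventually (\<lambda>n. p n \<le> 4 * real n powr (- 1 / (2 * d))) sequentially"
      using ev1
    proof eventually_elim
      case (elim n)
      have "p n \<le> 4 * x n / real n ^ 2"
        unfolding p_def using Lx[of n] by (intro divide_right_mono) auto
      also have "real n ^ 2 = real n powr 2" using elim by (simp add: powr_numeral)
      also have "4 * x n / real n powr 2 = 4 * real n powr (- 1 / (2 * d))"
      proof -
        have "real n powr (- 1 / (2 * d)) = real n powr ((2 - 1 / (2 * d)) - 2)" by simp
        also have "\<dots> = x n / real n powr 2" unfolding x_def by (rule powr_diff)
        finally show ?thesis by simp
      qed
      finally show ?case .
    qed
    show "(\<lambda>n. 4 * real n powr (- 1 / (2 * d))) \<longlonglongrightarrow> 0"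
      using assms(4) by real_asymp
  qed (auto simp: p_def)
  \<comment> \<open>Here the exponent of the threshold enters: \<open>p\<close> equals
    \<open>4 * R * u\<close> times \<open>n powr (- (1 / d))\<close>, whose power with exponent
    \<open>- d\<close> is exactly \<open>n\<close> and cancels the denominator of
    \<open>\<epsilon>\<close>.\<close>
  have \<epsilon>_eq: "eventually (\<lambda>n. \<epsilon> n = (4 * real R * u n) powr (- d)) sequentially"
    using ev1
  proof eventually_elim
    case (elim n)
    have p_eq: "p n = 4 * real R * u n * real n powr (- (1 / d))"
    proof -
      have "real n ^ 2 = g n * real n powr (1 / d)"
        unfolding g_def powr_add[symmetric] using elim by (simp add: powr_numeral)
      moreover have "real n powr (- (1 / d)) = 1 / real n powr (1 / d)" by (simp add: powr_minus_divide)
      ultimately show ?thesis unfolding p_def u_def by simp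
    qed
    have "p n powr (- d) = (4 * real R * u n) powr (- d) * (real n powr (- (1 / d))) powr (- d)"
      unfolding p_eq by (rule powr_mult)
    also have "(real n powr (- (1 / d))) powr (- d) = real n"
      using elim assms(4) by (simp add: powr_powr)
    finally show ?case unfolding \<epsilon>_def using elim by simp
  qed
  have "filterlim (\<lambda>n. 4 * real R * u n) at_top sequentially"
    using R by (intro filterlim_tendsto_pos_mult_at_top[OF tendsto_const _ u_top]) auto
  then have "(\<lambda>n. (4 * real R * u n) powr (- d)) \<longlonglongrightarrow> 0"
    using assms(4) by (intro tendsto_neg_powr) auto
  then have \<epsilon>_lim: "\<epsilon> \<longlonglongrightarrow> 0"
    using \<epsilon>_eq by (simp add: tendsto_cong)
  let ?Pr = "\<lambda>n. measure_pmf.prob (online_game F n (\<sigma> n) (N n)) {h. mono_copy F n h}"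
  show "?Pr \<longlonglongrightarrow> 1"
  proof (rule tendsto_sandwich[where f = "\<lambda>n. 1 - D * (p n + \<epsilon> n)" and h = "\<lambda>_. 1"])
    have "(\<lambda>n. 1 - D * (p n + \<epsilon> n)) \<longlonglongrightarrow> 1 - D * (0 + 0)"
      by (intro tendsto_intros p_lim \<epsilon>_lim)
    then show "(\<lambda>n. 1 - D * (p n + \<epsilon> n)) \<longlonglongrightarrow> 1" by simp
    have "eventually (\<lambda>n. p n < 1) sequentially"
      using order_tendstoD(2)[OF p_lim, of 1] by simp
    moreover have "(\<lambda>n. real a * \<epsilon> n) \<longlonglongrightarrow> real a * 0"
      by (intro tendsto_intros \<epsilon>_lim)
    then have "eventually (\<lambda>n. real a * \<epsilon> n < 1) sequentially"
      by (rule order_tendstoD(2)) simp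
    moreover have "eventually (\<lambda>n. u n > 0) sequentially"
      using u_top by (simp add: filterlim_at_top_dense)
    moreover have "eventually (\<lambda>n. a \<le> n \<and> 2 \<le> n) sequentially"
      by (intro eventually_conj eventually_ge_at_top)
    ultimately show "eventually (\<lambda>n. 1 - D * (p n + \<epsilon> n) \<le> ?Pr n) sequentially"
    proof eventually_elim
      case (elim n)
      have L0: "0 < L n" using elim(3) by (cases "L n = 0") (auto simp: u_def)
      have q: "real a * p n powr (- d) \<le> real n"
        using elim(2,4) by (simp add: \<epsilon>_def divide_less_eq)
      have "1 - D * (p n + \<epsilon> n)
          \<le> 1 - measure_pmf.prob (kernel_iter (free_step n (\<sigma> n)) (R * L n) []) {H. \<not> mono_copy F n H}"
        using bound[OF L0 _ _ p_def _ q] elim by (simp add: \<epsilon>_def)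
      also have "\<dots> = measure_pmf.prob (kernel_iter (free_step n (\<sigma> n)) (R * L n) []) {H. mono_copy F n H}"
        using measure_pmf.prob_compl[of "{H. \<not> mono_copy F n H}" "kernel_iter (free_step n (\<sigma> n)) (R * L n) []"]
        by (simp add: Compl_eq_Diff_UNIV[symmetric] Collect_neg_eq[symmetric])
      \<comment> \<open>The rounds use only \<open>R * L n \<le> N n\<close> steps; the remaining
        ones cannot destroy a copy.\<close>
      also have "\<dots> \<le> measure_pmf.prob (kernel_iter (free_step n (\<sigma> n)) (N n) []) {H. mono_copy F n H}"
        using LN[of n] by (intro prob_mono_copy_free_mono) simp
      also have "\<dots> = ?Pr n"
        by (simp add: online_game_eq_kernel_iter prob_mono_copy_free)
      finally show ?case .
    qed
  qed auto
qed

end
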